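(* Let $(G,D)$ be a connected $3$-transposition group with $\tau(G)\ne 1$, so that $G=2^{\bullet h}\bar G$ with $h\geq 1$ and $\bar G=G/\tau(G)$. Let $M=M_\eta(G,D)$ and $\bar M=M_\eta(\bar G,\bar D)$, with collinearity maps $t$ and $\bar t$ respectively, and let $U=\langle c-d\mid c,d\in D,\ c\,\tau\, d\rangle\subseteq M$. Then: (a) The non-zero eigenvalues of $t$ are of the form $\rho=2^h\bar\rho$, where $\bar\rho$ is an eigenvalue of $\bar t$. Furthermore, the multiplicity of $\rho$ in $M$ is the same as the multiplicity of $\bar\rho$ in $\bar M$. (b) The multiplicity of the eigenvalue $0$ of $t$ in $M$ is $\dim(U)=\dim(M)-\dim(\bar M)=|D|-|\bar D|=(2^h-1)|\bar D|$.
   Context: $\mathbb F$ is a field of characteristic $0$ and $\eta\in\mathbb F\setminus\{0,1\}$. A $3$-transposition group $(G,D)$ is a finite group $G$ with a normal generating subset $D$ of elements of order $2$ such that $|de|\le 3$ for all $d,e\in D$; it is connected if $D$ is a single conjugacy class. As a vector space, the Matsuo algebra $M_\eta(G,D)$ is the $\mathbb F$-space with basis $D$ (the algebra product is not needed here). For $d\in D$ put $A_d=\{e\in D\mid |de|=3\}$. The collinearity map is the linear map $t:M\to M$, $t(d)=\sum_{c\in A_d}c$ for $d\in D$. The map $\bar t$ is defined in the same way for $(\bar G,\bar D)$. The equivalence relation $\tau$ on $D$ is: $d\,\tau\,e$ iff $A_d=A_e$. The normal subgroup $\tau(G)$ is $\langle de\mid d,e\in D,\ d\,\tau\,e\rangle$;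 it is a $2$-group. When $\tau(G)\neq1$, $|D\cap d\tau(G)|=2^h$ for some $h\ge1$ independent of $d\in D$; $\bar G=G/\tau(G)$, $\bar D$ is the image of $D$ in $\bar G$, $(\bar G,\bar D)$ is a $3$-transposition group and $|D|=2^h|\bar D|$; this situation is denoted $G=2^{\bullet h}\bar G$. *)

theory Defs
  imports
    "HOL-Algebra.Algebra"
    "HOL-Library.Function_Algebras"
begin

section \<open>3-transposition groups\<close>

locale three_transposition_group = group G for G (structure) +
  fixes D :: "'a set"
  assumes finite_carrier: "finite (carrier G)"
    and D_subset: "D \<subseteq> carrier G"
    and D_generates: "generate G D = carrier G"
    and D_normal: "\<lbrakk>g \<in> carrier G; d \<in> D\<rbrakk> \<Longrightarrow> g \<otimes> d \<otimes> inv g \<in> D"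
    and D_involution: "d \<in> D \<Longrightarrow> ord d = 2"
    and D_product: "\<lbrakk>d \<in> D; e \<in> D\<rbrakk> \<Longrightarrow> ord (d \<otimes> e) \<le> 3"

locale connected_three_transposition_group = three_transposition_group +
  assumes connected: "\<exists>d\<in>D. D = {g \<otimes> d \<otimes> inv g | g. g \<in> carrier G}"

definition collinear_set :: "('a, 'b) monoid_scheme \<Rightarrow> 'a set \<Rightarrow> 'a \<Rightarrow> 'a set"
  where "collinear_set G D d = {e \<in> D. group.ord G (d \<otimes>\<^bsub>G\<^esub> e) = 3}"

definition tau_rel :: "('a, 'b) monoid_scheme \<Rightarrow> 'a set \<Rightarrow> 'a \<Rightarrow> 'a \<Rightarrow> bool"
  where "tau_rel G D d e \<longleftrightarrow> collinear_set G D d = collinear_set G D e"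

definition tau_subgroup :: "('a, 'b) monoid_scheme \<Rightarrow> 'a set \<Rightarrow> 'a set"
  where "tau_subgroup G D = generate G {d \<otimes>\<^bsub>G\<^esub> e | d e. d \<in> D \<and> e \<in> D \<and> tau_rel G D d e}"

definition tau_quotient :: "('a, 'b) monoid_scheme \<Rightarrow> 'a set \<Rightarrow> 'a set monoid"
  where "tau_quotient G D = G Mod tau_subgroup G D"

definition tau_quotient_set :: "('a, 'b) monoid_scheme \<Rightarrow> 'a set \<Rightarrow> 'a set set"
  where "tau_quotient_set G D = (\<lambda>d. tau_subgroup G D #>\<^bsub>G\<^esub> d) ` D"

text \<open>The situation written $G = 2^{\bullet h}\bar G$; this determines \<open>h\<close> when \<open>D\<close> is nonempty.\<close>

definition two_bullet_extension :: "('a, 'b) monoid_scheme \<Rightarrow> 'a set \<Rightarrow> nat \<Rightarrow> bool"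
  where "two_bullet_extension G D h \<longleftrightarrow>
    h \<ge> 1 \<and> (\<forall>d\<in>D. card (D \<inter> (d <#\<^bsub>G\<^esub> tau_subgroup G D)) = 2 ^ h)"

section \<open>The space underlying a Matsuo algebra\<close>

definition fscale :: "'f::field \<Rightarrow> ('a \<Rightarrow> 'f) \<Rightarrow> 'a \<Rightarrow> 'f"
  where "fscale c v = (\<lambda>x. c * v x)"

interpretation fun_space: vector_space fscale
  by unfold_locales (auto simp: fscale_def fun_eq_iff algebra_simps)

definition basis_vec :: "'a \<Rightarrow> 'a \<Rightarrow> 'f::field"
  where "basis_vec d = (\<lambda>x. if x = d then 1 else 0)"

text \<open>The parameter \<open>\<eta>\<close> enters only the multiplication of the Matsuo algebra, which is not used
  here; the underlying vector space does not depend on it.\<close>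

definition matsuo_space :: "'f::field \<Rightarrow> 'a set \<Rightarrow> ('a \<Rightarrow> 'f) set"
  where "matsuo_space \<eta> D = fun_space.span (basis_vec ` D)"

text \<open>The linear extension of \<open>d \<mapsto> (\<Sum>c\<in>collinear_set G D d. c)\<close>; it is meaningful
  on \<open>matsuo_space \<eta> D\<close> only, coordinates outside \<open>D\<close> being ignored.\<close>

definition collinearity_map ::
  "('a, 'b) monoid_scheme \<Rightarrow> 'a set \<Rightarrow> ('a \<Rightarrow> 'f::field) \<Rightarrow> 'a \<Rightarrow> 'f"
  where "collinearity_map G D v =
    (\<Sum>d\<in>D. fscale (v d) (\<Sum>c\<in>collinear_set G D d. basis_vec c))"

definition tau_difference_space ::
  "('a, 'b) monoid_scheme \<Rightarrow> 'a set \<Rightarrow> ('a \<Rightarrow> 'f::field) set"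
  where "tau_difference_space G D =
    fun_space.span {basis_vec c - basis_vec d | c d. c \<in> D \<and> d \<in> D \<and> tau_rel G D c d}"

section \<open>Eigenvalues on an invariant subspace\<close>

definition eigenspace_on ::
  "('a \<Rightarrow> 'f::field) set \<Rightarrow> (('a \<Rightarrow> 'f) \<Rightarrow> 'a \<Rightarrow> 'f) \<Rightarrow> 'f \<Rightarrow> ('a \<Rightarrow> 'f) set"
  where "eigenspace_on M t \<rho> = {v \<in> M. t v = fscale \<rho> v}"

definition eigenvalue_on ::
  "('a \<Rightarrow> 'f::field) set \<Rightarrow> (('a \<Rightarrow> 'f) \<Rightarrow> 'a \<Rightarrow> 'f) \<Rightarrow> 'f \<Rightarrow> bool"
  where "eigenvalue_on M t \<rho> \<longleftrightarrow> (\<exists>v\<in>eigenspace_on M t \<rho>. v \<noteq> 0)"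

text \<open>Geometric multiplicity. For a collinearity map in characteristic 0 it agrees with the
  algebraic one: the matrix is rational and symmetric, hence has squarefree minimal polynomial.\<close>

definition multiplicity_on ::
  "('a \<Rightarrow> 'f::field) set \<Rightarrow> (('a \<Rightarrow> 'f) \<Rightarrow> 'a \<Rightarrow> 'f) \<Rightarrow> 'f \<Rightarrow> nat"
  where "multiplicity_on M t \<rho> = fun_space.dim (eigenspace_on M t \<rho>)"

end

theory Submission
  imports Defs
begin

text \<open>Conjugation turns \<open>D\<close> into a quandle; write \<open>A\<close> for the adjacency matrix of
  non-commutation. Elements of \<open>D\<close> have the same image in \<open>G / \<tau>(G)\<close> exactly
  when they have the same neighbours (they are twins), so \<open>A\<close> is the \<open>2\<^sup>h\<close>-fold
  blow-up of the matrix of the quotient and eigenvectors for non-zero eigenvalues are pulled back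
  from the quotient. The point is that a vector \<open>v\<close> with \<open>A v = 0\<close> has zero sum
  on each class of twins. The entries of \<open>A\<^sup>2\<close> count common neighbours.
  If some plane is affine, then elements of order 3 acting freely on the relevant sets of neighbours
  show that these counts are 2, 1 and 0 modulo 3 for twins, adjacent pairs and other pairs, so
  \<open>A\<^sup>2 - A\<close> is 2 times the twin relation modulo 3, which is invertible on classes.
  If no plane is affine, then with \<open>k\<close> the valency the counts are \<open>k\<close> and
  \<open>k / 2\<close> for twins and adjacent pairs, and a constant smaller than \<open>k\<close>
  for the other pairs.\<close>

text \<open>The zero class sums amount to nonsingularity of the quotient matrix. For an affine plane
  spanned by \<open>d\<close>, \<open>c\<close>, \<open>p\<close> put \<open>s = dc\<close>. Every
  point of the plane inverts the translations modulo the centre of the group that the plane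
  generates, so \<open>z = s * s^p\<close> is central there: it fixes the plane, yet it moves every
  point other than \<open>d\<close> that commutes with \<open>d\<close> but not with
  \<open>c\<close>. This is the source of the free actions. The obstacle is a count for commuting
  points \<open>d\<close> and \<open>e\<close>. It has to be made among the points that commute with
  \<open>e\<close>, and \<open>z\<close> need not preserve them if \<open>e\<close> and
  \<open>p\<close> do not commute. Then \<open>z\<close> is replaced by \<open>z * z^e\<close>, the
  same construction one level up. Without affine planes there is no \<open>z\<close>. There, as far
  as adjacency is concerned, the third point of a line is the sum of the other two over the field
  with two elements, and linear relations take over from group actions.\<close>

lemma commuting_cubed:
  assumes "\<And>x. s (t x) = t (s x)" "\<And>x. s (s (s x)) = x" "\<And>x. t (t (t x)) = x"
  shows "s (t (s (t (s (t x))))) = x"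
  using assms by metis

lemma three_dvd_card:
  assumes "finite A" "\<And>x. x \<in> A \<Longrightarrow> h x \<in> A" "\<And>x. x \<in> A \<Longrightarrow> h x \<noteq> x"
    "\<And>x. x \<in> A \<Longrightarrow> h (h (h x)) = x"
  shows "3 dvd card A"
  using assms
proof (induction A rule: finite_psubset_induct)
  case (psubset A)
  show ?case
  proof (cases "A = {}")
    case False
    then obtain x where x: "x \<in> A" by blast
    define Y where "Y = {x, h x, h (h x)}"
    have Y: "Y \<subseteq> A" "finite Y" using x psubset.prems(1) by (auto simp: Y_def)
    have "h (h x) \<noteq> x" using psubset.prems x by metis
    moreover have "h (h x) \<noteq> h x" "h x \<noteq> x" using psubset.prems x by auto
    ultimately have card: "card Y = 3" by (auto simp: Y_def)
    have "3 dvd card (A - Y)"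
    proof (rule psubset.IH)
      show "A - Y \<subset> A" using Y x by (auto simp: Y_def)
      fix y assume y: "y \<in> A - Y"
      have "h y \<notin> Y"
      proof
        assume "h y \<in> Y"
        then have "h (h (h y)) \<in> Y" using psubset.prems(3)[OF x] by (auto simp: Y_def)
        then show False using y psubset.prems(3) by auto
      qed
      then show "h y \<in> A - Y" using psubset.prems y by auto
    qed (use psubset.prems in auto)
    moreover have "card A = card (A - Y) + card Y"
      using Y psubset.hyps by (metis card_Diff_subset card_mono le_add_diff_inverse2)
    ultimately show ?thesis by (simp add: card)
  qed simp
qed

section \<open>Reflection quandles\<close>

text \<open>\<open>r d x\<close> models the conjugate of \<open>x\<close> by \<open>d\<close>,
  extended by the identity off \<open>D\<close> so that the laws hold without membership hypotheses.
  \<open>r_swap\<close> is the braid relation \<open>dxd = xdx\<close> of two involutions whose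
  product has order 3.\<close>

locale reflection_quandle =
  fixes D :: "'a set" and r :: "'a \<Rightarrow> 'a \<Rightarrow> 'a"
  assumes finite_D: "finite D"
    and r_r [simp]: "r d (r d x) = x"
    and r_self [simp]: "r d d = d"
    and r_dist: "r d (r e x) = r (r d e) (r d x)"
    and r_swap: "r d x \<noteq> x \<Longrightarrow> r d x = r x d"
    and moved_in_D: "r d x \<noteq> x \<Longrightarrow> x \<in> D"
begin

definition adj :: "'a \<Rightarrow> 'a \<Rightarrow> bool"
  where "adj x y \<longleftrightarrow> r x y \<noteq> y"

definition nbrs :: "'a \<Rightarrow> 'a set"
  where "nbrs x = {y. adj x y}"

lemma r_eq_iff [simp]: "r d x = r d y \<longleftrightarrow> x = y"
  by (metis r_r)

lemma adj_sym: "adj x y \<longleftrightarrow> adj y x"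
  unfolding adj_def by (metis r_r r_self r_swap)

lemma not_adj_self [simp]: "\<not> adj x x"
  by (simp add: adj_def)

lemma adj_r [simp]: "adj (r g x) (r g y) \<longleftrightarrow> adj x y"
  unfolding adj_def by (metis r_dist r_eq_iff)

lemma adj_r_left: "adj (r g x) y \<longleftrightarrow> adj x (r g y)"
  by (metis adj_r r_r)

lemma r_conj: "r (r d e) x = r d (r e (r d x))"
  by (metis r_dist r_r)

lemma r_adj: "adj x y \<Longrightarrow> r x y = r y x"
  unfolding adj_def by (rule r_swap)

lemma r_not_adj [simp]: "\<not> adj x y \<Longrightarrow> r x y = y"
  by (simp add: adj_def)

lemma adj_D: "adj x y \<Longrightarrow> x \<in> D" "adj x y \<Longrightarrow> y \<in> D"
  using adj_sym adj_def moved_in_D by blast+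

lemma finite_nbrs [simp]: "finite (nbrs x)"
  by (rule finite_subset[OF _ finite_D]) (auto simp: nbrs_def dest: adj_D)

lemma mem_nbrs [simp]: "y \<in> nbrs x \<longleftrightarrow> adj x y"
  by (simp add: nbrs_def)

lemma not_adj_third: "\<not> adj w x \<Longrightarrow> \<not> adj w y \<Longrightarrow> \<not> adj w (r x y)"
  by (metis adj_def r_dist)

lemma adj_line:
  assumes "adj x y"
  shows "adj x (r x y)" "adj y (r x y)"
proof -
  show "adj x (r x y)" using adj_r[of x x y] assms by simp
  show "adj y (r x y)" using adj_r[of y y x] assms by (simp add: adj_sym r_adj)
qed

lemma r_line:
  assumes "adj x y"
  shows "r (r x y) x = y" "r (r x y) y = x"
proof -
  show "r (r x y) x = y"
    using r_adj[OF adj_line(1)[OF assms]] by simp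
  show "r (r x y) y = x"
    using r_adj[OF adj_line(2)[OF assms]] r_adj[OF assms] by simp
qed

text \<open>Otherwise \<open>w\<close> would miss two points of the line and hence, by
  \<open>not_adj_third\<close>, also \<open>x\<close>. So a point is adjacent to 0, 2 or 3 points of
  a line.\<close>

lemma adj_third:
  assumes "adj x y" "adj w x" "\<not> adj w y"
  shows "adj w (r x y)"
  using not_adj_third[of w "r x y" y] r_line[OF assms(1)] assms by auto

lemma card_nbrs_r: "card (nbrs (r g x)) = card (nbrs x)"
proof -
  have "bij_betw (r g) (nbrs x) (nbrs (r g x))"
    by (rule bij_betw_byWitness[where f' = "r g"]) (auto simp: adj_r_left)
  then show ?thesis by (simp add: bij_betw_same_card)
qed

lemma card_nbrs_adj: "adj x y \<Longrightarrow> card (nbrs x) = card (nbrs y)"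
  by (metis card_nbrs_r r_line(1))

lemma card_common_r: "card (nbrs (r g x) \<inter> nbrs (r g y)) = card (nbrs x \<inter> nbrs y)"
proof -
  have "bij_betw (r g) (nbrs x \<inter> nbrs y) (nbrs (r g x) \<inter> nbrs (r g y))"
    by (rule bij_betw_byWitness[where f' = "r g"]) (auto simp: adj_r_left)
  then show ?thesis by (simp add: bij_betw_same_card)
qed

subsection \<open>Affine planes\<close>

text \<open>\<open>aff d c p\<close> says that \<open>d\<close>, \<open>c\<close>, \<open>p\<close> span an affine plane of order 3:
  \<open>p\<close> is adjacent to every point of the line through \<open>d\<close> and \<open>c\<close>.
  Then \<open>twist d c p\<close> is an inner automorphism of order dividing 3 that fixes the plane
  pointwise.\<close>

definition aff :: "'a \<Rightarrow> 'a \<Rightarrow> 'a \<Rightarrow> bool"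
  where "aff d c p \<longleftrightarrow> adj d c \<and> adj p d \<and> adj p c \<and> adj p (r d c)"

text \<open>Conjugation by the product \<open>dc\<close>; for adjacent \<open>d\<close> and
  \<open>c\<close> it rotates their line.\<close>

definition shift :: "'a \<Rightarrow> 'a \<Rightarrow> 'a \<Rightarrow> 'a"
  where "shift d c x = r d (r c x)"

definition twist :: "'a \<Rightarrow> 'a \<Rightarrow> 'a \<Rightarrow> 'a \<Rightarrow> 'a"
  where "twist d c p x = shift d c (r p (shift d c (r p x)))"

lemma shift_r: "shift d c (r x y) = r (shift d c x) (shift d c y)"
  unfolding shift_def by (metis r_dist)

lemma twist_r: "twist d c p (r x y) = r (twist d c p x) (twist d c p y)"
  unfolding twist_def by (metis shift_r r_dist)

lemma shift_eq_iff [simp]: "shift d c x = shift d c y \<longleftrightarrow> x = y"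
  by (simp add: shift_def)

lemma twist_eq_iff [simp]: "twist d c p x = twist d c p y \<longleftrightarrow> x = y"
  by (simp add: twist_def)

lemma adj_shift [simp]: "adj (shift d c x) (shift d c y) \<longleftrightarrow> adj x y"
  by (simp add: shift_def)

lemma adj_twist [simp]: "adj (twist d c p x) (twist d c p y) \<longleftrightarrow> adj x y"
  by (simp add: twist_def)

lemma aff_swap:
  assumes "aff d c p"
  shows "aff d p c"
proof -
  have "adj (r d p) c" using assms by (simp add: aff_def adj_r_left)
  then have "adj c (r d p)" by (simp add: adj_sym)
  then show ?thesis using assms adj_sym by (auto simp: aff_def)
qed

lemma aff_rotate:
  assumes "aff d c p"
  shows "aff c p d"
proof -
  have "adj p (r c d)" using assms r_adj[of d c] by (simp add: aff_def)
  then have "adj (r c p) d" by (simp add: adj_r_left)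
  then have "adj d (r c p)" by (simp add: adj_sym)
  then show ?thesis using assms adj_sym by (auto simp: aff_def)
qed

lemma braid: "adj d c \<Longrightarrow> r d (r c (r d x)) = r c (r d (r c x))"
  by (metis r_adj r_conj)

lemma shift_line:
  assumes "adj d c"
  shows "shift d c d = c" "shift d c c = r d c" "shift d c (r d c) = d"
  using assms by (simp_all add: shift_def r_adj)  (metis r_adj r_r)

lemma shift_shift:
  assumes "adj d c"
  shows "shift c (r d c) = shift d c" "shift (r d c) d = shift d c"
proof -
  show "shift c (r d c) = shift d c"
    by (rule ext) (simp add: shift_def r_conj braid[OF assms])
  show "shift (r d c) d = shift d c"
    by (rule ext) (simp add: shift_def r_conj)
qed

lemma shift_cubed:
  assumes "adj d c"
  shows "shift d c (shift d c (shift d c x)) = x"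
  unfolding shift_def by (metis braid[OF assms] r_r)

text \<open>Since \<open>r p b = r b p\<close>, the inner \<open>r b\<close> cancels, and
  \<open>r a p = r p a\<close> finishes.\<close>

lemma conj_shift:
  assumes "adj p a" "adj p b"
  shows "r p (shift a b (r p b)) = a"
  unfolding shift_def by (metis assms r_adj r_r)

lemma twist_fixes:
  assumes "aff d c p"
  shows "twist d c p d = d" "twist d c p c = c" "twist d c p (r d c) = r d c" "twist d c p p = p"
proof -
  let ?f = "r d c"
  have a: "adj d c" "adj p d" "adj p c" "adj p ?f" using assms by (auto simp: aff_def)
  \<comment> \<open>Conjugated by \<open>p\<close>, the shift runs backwards along the line
    \<open>d\<close>, \<open>c\<close>, \<open>r d c\<close>; this is why the twist fixes its three
    points.\<close>
  have 1: "r p (shift d c (r p c)) = d" using conj_shift a by blast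
  have 2: "r p (shift d c (r p ?f)) = c" using conj_shift[of p c ?f] a shift_shift by simp
  have 3: "r p (shift d c (r p d)) = ?f" using conj_shift[of p ?f d] a shift_shift by simp
  show "twist d c p d = d" "twist d c p c = c" "twist d c p ?f = ?f"
    unfolding twist_def 1 2 3 using shift_line[OF a(1)] by auto
  have "twist d c p p = r d (r c (r p (r d (r c p))))" by (simp add: twist_def shift_def)
  also have "r c p = r p c" using a r_adj by metis
  also have "r p (r d (r p c)) = r (r p d) c" by (simp add: r_conj)
  also have "\<dots> = r d (r p ?f)" using a r_adj by (metis r_conj)
  also have "r d (r c (r d (r p ?f))) = r ?f (r p ?f)" by (simp add: r_conj)
  also have "\<dots> = p" using a by (metis r_adj r_r)
  finally show "twist d c p p = p" .
qed

text \<open>The twist is an automorphism fixing \<open>d\<close> and \<open>c\<close>, so it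
  commutes with \<open>shift d c\<close>. Being the product of this shift and its conjugate by
  \<open>p\<close>, it makes the two factors commute.\<close>

lemma shift_conj_commute:
  assumes "aff d c p"
  shows "shift d c (r p (shift d c (r p x))) = r p (shift d c (r p (shift d c x)))"
proof -
  let ?z = "twist d c p"
  have "?z (shift d c x) = shift d c (?z x)"
    unfolding shift_def[of d c] twist_r twist_fixes[OF assms] ..
  then show ?thesis by (simp add: twist_def)
qed

lemma twist_cubed:
  assumes "aff d c p"
  shows "twist d c p (twist d c p (twist d c p x)) = x"
proof -
  have a: "adj d c" using assms by (auto simp: aff_def)
  show ?thesis
    unfolding twist_def
    by (rule commuting_cubed[where s = "shift d c" and t = "\<lambda>x. r p (shift d c (r p x))"])
      (use shift_conj_commute[OF assms] shift_cubed[OF a] in auto)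
qed

lemma twist_r_commute:
  assumes "aff d c p" "x = d \<or> x = c \<or> x = r d c \<or> x = p"
  shows "twist d c p (r x y) = r x (twist d c p y)"
  using assms twist_r twist_fixes[OF assms(1)] by metis

text \<open>That the twist fixes \<open>p\<close> means that the orbit of \<open>p\<close> under
  \<open>shift d c\<close> is a line, the parallel through \<open>p\<close>.\<close>

lemma r_shift_fixed:
  assumes "aff d c p"
  shows "r p (shift d c p) = shift d c (shift d c p)" "adj p (shift d c p)"
proof -
  have a: "adj d c" "adj p d" "adj p c" using assms by (auto simp: aff_def)
  have "shift d c (r p (shift d c p)) = p"
    using twist_fixes(4)[OF assms] by (simp add: twist_def)
  then show 1: "r p (shift d c p) = shift d c (shift d c p)"
    by (metis shift_cubed[OF a(1)] shift_eq_iff)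
  have "shift d c p \<noteq> p"
  proof
    assume "shift d c p = p"
    then have "r c p = r d p" unfolding shift_def by (metis r_r)
    then have "r p c = r p d" using a r_adj by metis
    with a show False by simp
  qed
  then show "adj p (shift d c p)"
    unfolding adj_def 1 by simp
qed

lemma aff_reflect:
  assumes "aff d c p" "x = d \<or> x = c \<or> x = r d c"
  shows "aff d c (r x p)"
proof -
  have a: "adj d c" "adj p d" "adj p c" "adj p (r d c)" using assms by (auto simp: aff_def)
  have "r c (r d c) = d" using a(1) by (metis r_adj r_r)
  then show ?thesis
    using assms(2) a r_line[OF a(1)] r_adj[OF a(1), symmetric] by (elim disjE) (simp_all add: aff_def adj_r_left)
qed

text \<open>Each \<open>x\<close> on the line inverts \<open>shift d c\<close> and commutes with the
  twist; together these turn the twist for the reflected point into the inverse.\<close>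

lemma twist_reflect:
  assumes "aff d c p" "x = d \<or> x = c \<or> x = r d c"
  shows "twist d c (r x p) (twist d c p y) = y"
proof -
  have a: "adj d c" using assms by (auto simp: aff_def)
  have b: "aff d c (r x p)" by (rule aff_reflect[OF assms])
  have inv: "shift d c (r x (shift d c y)) = r x y" for y
    using assms(2)
  proof (elim disjE)
    assume "x = r d c"
    then show ?thesis by (simp add: shift_def r_conj)
  next
    assume "x = d"
    then show ?thesis by (simp add: shift_def)
  next
    assume "x = c"
    then show ?thesis by (simp add: shift_def braid[OF a, symmetric])
  qed
  have "twist d c (r x p) (r x (twist d c p w)) = r x w" for w
    by (simp add: twist_def r_conj inv shift_conj_commute[OF assms(1)])
  note 1 = this[of "r x y"]
  have "twist d c p (r x (r x y)) = r x (twist d c p (r x y))"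
    using twist_r_commute[OF assms(1)] assms(2) by blast
  with 1 show ?thesis by simp
qed

subsection \<open>Counting modulo three\<close>

text \<open>As \<open>d\<close> and \<open>p\<close> fix \<open>g\<close>, a fixed point would
  satisfy \<open>r d m = r p m\<close> at \<open>m = r c g = r g c\<close>. Reflecting in
  \<open>g\<close> gives \<open>r d c = r p c\<close>, which forces \<open>d = p\<close>.\<close>

lemma twist_moves_off_line:
  assumes a: "aff d c p" and g: "\<not> adj g d" "adj g c" "\<not> adj g p"
  shows "twist d c p g \<noteq> g"
proof
  assume "twist d c p g = g"
  moreover have gd: "r d g = g" "r p g = g" using g adj_sym by auto
  ultimately have "r p (r d (r c g)) = r c g"
    unfolding twist_def shift_def by (metis r_r)
  then have "r d (r c g) = r p (r c g)" by (metis r_r)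
  then have "r d (r g c) = r p (r g c)" using g(2) by (simp add: r_adj)
  then have "r g (r d (r g c)) = r g (r p (r g c))" by simp
  then have "r d c = r p c" using g by (simp add: r_conj[symmetric])
  then have "r c d = r c p" using a unfolding aff_def by (metis r_adj)
  then show False using a by (simp add: aff_def)
qed

text \<open>The orbit of \<open>g\<close> under \<open>shift d c\<close> is \<open>g\<close>,
  \<open>r d m\<close>, \<open>m\<close> with \<open>m = r c g\<close>, which expresses the image of
  \<open>g\<close> by \<open>p\<close> and \<open>m\<close>. Both claims then compare
  \<open>r c d\<close> with \<open>r c g\<close>: equality would give \<open>g = d\<close>,
  adjacency would give \<open>adj g d\<close>.\<close>

lemma twist_moves_off_point:
  assumes a: "aff d c p" and g: "\<not> adj g d" "g \<noteq> d" "adj g c"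
    and gp: "adj g p" "adj g (r c p)" "adj g (r (r d c) p)"
  shows "twist d c p g \<noteq> g" "\<not> adj g (twist d c p g)"
proof -
  let ?f = "r d c" and ?m = "r c g" and ?s = "shift d c"
  have a': "adj d c" "adj p d" "adj p c" "adj p ?f" using a by (auto simp: aff_def)
  have dg: "r d g = g" using g adj_sym by auto
  have pm: "adj p ?m" using gp(2) by (metis adj_r_left adj_sym)
  have sg: "?s g = r d ?m" by (simp add: shift_def)
  have f: "r ?f x = r c (r d (r c x))" for x using a' by (metis r_adj r_conj)
  have "r ?f g = ?s g" by (simp add: sg dg r_conj)
  then have psg: "adj p (?s g)" using gp(3) by (metis adj_r_left adj_sym)
  have "?s ?m = g" by (simp add: shift_def dg)
  then have ssg: "?s (?s g) = ?m" by (metis a'(1) shift_cubed)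
  have "twist d c p g = r p (?s (r p (?s g)))"
    using shift_conj_commute[OF a, of g] by (simp add: twist_def)
  also have "\<dots> = r p (?s (r (?s g) p))" using r_adj[OF psg] by simp
  also have "\<dots> = r p (r ?m (?s p))" by (simp add: shift_r ssg)
  finally have z: "twist d c p g = r p (r ?m (?s p))" .
  have fm: "?f = r c d" using a' by (simp add: r_adj)
  have pf: "r p ?f = r ?f p" "r p ?m = r ?m p" using r_adj[OF a'(4)] r_adj[OF pm] by auto
  have "r c (r d (r ?m (r g p))) = r ?f (r (r g c) p)"
    by (simp only: f) (simp add: r_conj)
  then have key: "r c (r d (r ?m (r g p))) = r ?f (r ?m p)"
    using g(3) by (simp add: r_adj)
  have inv: "r c (r d (?s p)) = p" by (simp add: shift_def)
  show "twist d c p g \<noteq> g"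
  proof
    assume "twist d c p g = g"
    then have "r ?m (?s p) = r g p" unfolding z using gp(1) by (metis r_adj r_r)
    then have "?s p = r ?m (r g p)" by (metis r_r)
    then have "p = r ?f (r ?m p)" using key inv by simp
    then have "r p ?f = r p ?m" unfolding pf by (metis r_r)
    then show False using g(2) by (simp add: fm)
  qed
  show "\<not> adj g (twist d c p g)"
  proof
    assume "adj g (twist d c p g)"
    then have "adj (r p g) (r ?m (?s p))" unfolding z by (simp add: adj_r_left)
    then have "adj (r g p) (r ?m (?s p))" using r_adj[OF gp(1)] by simp
    then have "adj (r ?m (r g p)) (?s p)" by (simp only: adj_r_left)
    then have "adj (r c (r d (r ?m (r g p)))) (r c (r d (?s p)))" by simp
    then have "adj (r ?f (r ?m p)) p" unfolding key inv .
    then have "adj (r p ?m) (r p ?f)" unfolding pf by (simp add: adj_r_left)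
    then show False using g(1) by (simp add: fm)
  qed
qed

text \<open>A map and its inverse have the same fixed points, so \<open>twist_reflect\<close> allows
  \<open>p\<close> to be replaced by \<open>r c p\<close> or \<open>r (r d c) p\<close>. Either
  \<open>g\<close> misses one of these three points, or it is adjacent to all of them.\<close>

lemma twist_moves:
  assumes a: "aff d c p" and g: "\<not> adj g d" "g \<noteq> d" "adj g c"
  shows "twist d c p g \<noteq> g"
proof (cases "adj g p \<and> adj g (r c p) \<and> adj g (r (r d c) p)")
  case True
  then show ?thesis using twist_moves_off_point(1)[OF a g] by blast
next
  case False
  then consider "\<not> adj g p" | x where "x = c \<or> x = r d c" "\<not> adj g (r x p)" by blast
  then show ?thesis
  proof cases
    case 1
    then show ?thesis using twist_moves_off_line[OF a g(1,3)] by blast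
  next
    case 2
    then have x: "x = d \<or> x = c \<or> x = r d c" by blast
    have "twist d c (r x p) g \<noteq> g"
      using twist_moves_off_line[OF aff_reflect[OF a x] g(1,3)] 2 by blast
    then show ?thesis using twist_reflect[OF a x, of g] by metis
  qed
qed

text \<open>For adjacent \<open>d\<close> and \<open>c\<close> the point \<open>d\<close> meets the
  other two conditions, but twists fix it, so it must be left out for the action to be free.\<close>

definition opp :: "'a \<Rightarrow> 'a \<Rightarrow> 'a set"
  where "opp d c = {g. g \<noteq> d \<and> \<not> adj g d \<and> adj g c}"

lemma finite_opp [simp]: "finite (opp d c)"
  by (rule finite_subset[OF _ finite_D]) (auto simp: opp_def dest: adj_D)

lemma finite_aff [simp]: "finite {g. aff d c g}"
  by (rule finite_subset[OF _ finite_D]) (auto simp: aff_def dest: adj_D)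

text \<open>A neighbour of \<open>c\<close> off the line is adjacent to both or to exactly one of
  \<open>d\<close> and \<open>r d c\<close>. The two kinds with exactly one are exchanged by
  \<open>r c\<close>, hence the factor 2. The closed set \<open>Q\<close> will be everything, or the
  points commuting with some \<open>e\<close>.\<close>

lemma card_nbrs_closed:
  assumes Q: "\<And>x y. x \<in> Q \<Longrightarrow> y \<in> Q \<Longrightarrow> r x y \<in> Q" and dc: "d \<in> Q" "c \<in> Q" "adj d c"
  shows "card (nbrs c \<inter> Q) = 2 + 2 * card (opp d c \<inter> Q) + card ({g. aff d c g} \<inter> Q)"
proof -
  let ?f = "r d c"
  have cd: "adj c d" and cf: "adj c ?f" and df: "adj d ?f" using dc adj_line adj_sym by auto
  have rc: "r c d = ?f" "r c ?f = d" using dc(3) by (metis r_adj r_r)+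
  have rc': "r c x = ?f \<longleftrightarrow> x = d" "adj x (r c d) \<longleftrightarrow> adj x ?f" for x
    by (metis r_eq_iff rc(1), simp add: rc)
  have "g \<in> nbrs c \<inter> Q \<longleftrightarrow> g \<in> {d, ?f} \<union> (opp d c \<inter> Q) \<union> (opp ?f c \<inter> Q) \<union> ({g. aff d c g} \<inter> Q)" for g
    using cd cf dc Q adj_sym by (auto simp: opp_def aff_def)
  then have "nbrs c \<inter> Q = {d, ?f} \<union> (opp d c \<inter> Q) \<union> (opp ?f c \<inter> Q) \<union> ({g. aff d c g} \<inter> Q)"
    by blast
  moreover have "opp d c \<inter> opp ?f c = {}"
  proof -
    have "\<not> adj g c" if "\<not> adj g d" "\<not> adj g ?f" for g
      using not_adj_third[OF that] by simp
    then show ?thesis by (auto simp: opp_def)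
  qed
  moreover have "d \<noteq> ?f" using df by auto
  moreover have "{d, ?f} \<inter> opp d c = {}" "{d, ?f} \<inter> opp ?f c = {}"
    using df adj_sym by (auto simp: opp_def)
  moreover have "({d, ?f} \<union> opp d c \<union> opp ?f c) \<inter> {g. aff d c g} = {}"
    by (auto simp: opp_def aff_def)
  ultimately have "card (nbrs c \<inter> Q) =
      2 + card (opp d c \<inter> Q) + card (opp ?f c \<inter> Q) + card ({g. aff d c g} \<inter> Q)"
    by (simp add: card_Un_disjoint Int_Un_distrib2 disjoint_iff)
  moreover have "bij_betw (r c) (opp d c \<inter> Q) (opp ?f c \<inter> Q)"
    by (rule bij_betw_byWitness[where f' = "r c"])
      (use rc rc' Q dc in \<open>auto simp: opp_def adj_r_left\<close>)
  then have "card (opp d c \<inter> Q) = card (opp ?f c \<inter> Q)" by (rule bij_betw_same_card)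
  ultimately show ?thesis by simp
qed

text \<open>\<open>shift d c\<close> acts freely, moving each \<open>g\<close> along the parallel
  line through it.\<close>

lemma three_dvd_aff:
  assumes Q: "\<And>x y. x \<in> Q \<Longrightarrow> y \<in> Q \<Longrightarrow> r x y \<in> Q" and dc: "d \<in> Q" "c \<in> Q" "adj d c"
  shows "3 dvd card ({g. aff d c g} \<inter> Q)"
proof (rule three_dvd_card[where h = "shift d c"])
  fix g assume g: "g \<in> {g. aff d c g} \<inter> Q"
  have l: "adj (shift d c g) x \<longleftrightarrow> adj g (r c (r d x))" for x
    by (simp add: shift_def adj_r_left)
  have "r c (r d c) = d" "r c d = r d c" using dc(3) by (metis r_adj r_r)+
  then show "shift d c g \<in> {g. aff d c g} \<inter> Q"
    using g dc Q by (auto simp: aff_def l) (auto simp: shift_def)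
  show "shift d c g \<noteq> g" using r_shift_fixed(2)[of d c g] g by auto
  show "shift d c (shift d c (shift d c g)) = g" by (rule shift_cubed[OF dc(3)])
qed simp

lemma card_common_adj:
  assumes "adj d c"
  shows "card (nbrs c) = card (nbrs d \<inter> nbrs c) + 1 + card (opp d c)"
proof -
  have "nbrs c = (nbrs d \<inter> nbrs c) \<union> {d} \<union> opp d c"
    using assms adj_sym by (auto simp: opp_def)
  moreover have "(nbrs d \<inter> nbrs c) \<inter> {d} = {}" "((nbrs d \<inter> nbrs c) \<union> {d}) \<inter> opp d c = {}"
    using adj_sym by (auto simp: opp_def)
  ultimately show ?thesis
    by (metis (no_types, lifting) card_Un_disjoint card.empty card.insert empty_iff
        finite.emptyI finite.insertI finite_Int finite_Un finite_nbrs finite_opp One_nat_def)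
qed

text \<open>The twist preserves the set because it fixes \<open>d\<close> and \<open>c\<close>, and
  it acts freely by \<open>twist_moves\<close>. Should it be the identity, the set is empty.\<close>

lemma three_dvd_opp:
  assumes "aff d c p"
  shows "3 dvd card (opp d c)"
proof (rule three_dvd_card[where h = "twist d c p"])
  fix g assume g: "g \<in> opp d c"
  have "adj (twist d c p g) d \<longleftrightarrow> adj g d" "adj (twist d c p g) c \<longleftrightarrow> adj g c"
    "twist d c p g = d \<longleftrightarrow> g = d"
    using twist_fixes[OF assms] by (metis adj_twist, metis adj_twist, metis twist_eq_iff)
  then show "twist d c p g \<in> opp d c" using g by (auto simp: opp_def)
  show "twist d c p g \<noteq> g" using twist_moves[OF assms] g by (auto simp: opp_def)
  show "twist d c p (twist d c p (twist d c p g)) = g" by (rule twist_cubed[OF assms])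
qed simp

text \<open>\<open>y\<close> is the twist times its conjugate by \<open>e\<close>. Since
  \<open>e\<close> commutes with \<open>shift d c\<close>, this conjugate is the twist for the point
  \<open>r e p\<close>; the two twists commute, so the cube of \<open>y\<close> is trivial.\<close>

lemma twist_commuting:
  assumes a: "aff d c p" and e: "\<not> adj e d" "\<not> adj e c" "adj e p"
  defines "y \<equiv> \<lambda>x. twist d c p (r e (twist d c p (r e x)))"
  shows "y d = d" "y c = c" "y e = e" "y (y (y x)) = x"
proof -
  let ?z = "twist d c p" and ?s = "shift d c" and ?q = "r e p"
  have a': "adj d c" using a by (simp add: aff_def)
  have re: "r e d = d" "r e c = c" using e by auto
  have s_re: "?s (r e x) = r e (?s x)" for x
    by (metis re r_dist shift_def)
  have zq: "twist d c ?q x = r e (?z (r e x))" for x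
    by (simp add: twist_def r_conj s_re)
  have pe: "r p e = ?q" using r_adj[OF e(3)] by simp
  have aq: "aff d c ?q" using a re by (simp add: aff_def adj_r_left r_dist[of e d c])
  show "y d = d" "y c = c" by (simp_all add: y_def re twist_fixes[OF a])
  let ?sp = "\<lambda>x. r p (?s (r p x))" and ?sq = "\<lambda>x. r ?q (?s (r ?q x))"
  have c1: "?s (?sp x) = ?sp (?s x)" "?s (?sq x) = ?sq (?s x)" for x
    using shift_conj_commute a aq by auto
  have q1: "r ?q x = r p (r e (r p x))" for x by (simp add: pe[symmetric] r_conj)
  \<comment> \<open>Here \<open>?q = pep\<close>. As \<open>e\<close> commutes with the shift, both
    sides are conjugates by \<open>pe\<close> of products of the shift and its conjugate by
    \<open>p\<close>, which commute.\<close>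
  have c2: "?sp (?sq x) = ?sq (?sp x)" for x
    by (simp add: q1 c1(1) s_re)
  have se: "?s e = e" using e adj_sym by (simp add: shift_def)
  have "?z e = r p (r e (?s p))"
    using c1(1)[of e] by (simp add: twist_def se pe s_re)
  then have "r e (?z e) = r ?q (?s p)" by (simp add: r_conj)
  also have "\<dots> = r p (r e (?s (?s p)))" using q1[of "?s p"] r_shift_fixed(1)[OF a] by simp
  finally have "y e = ?z (r p (r e (?s (?s p))))" by (simp add: y_def)
  also have "\<dots> = ?s (r p (r e p))" by (simp add: twist_def s_re shift_cubed[OF a'])
  also have "\<dots> = e" by (simp add: pe[symmetric] se)
  finally show "y e = e" .
  have "?z (twist d c ?q x) = twist d c ?q (?z x)" for x
    by (simp only: twist_def c1 c2)
  moreover have "y = (\<lambda>x. ?z (twist d c ?q x))" by (simp add: y_def zq)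
  ultimately show "y (y (y x)) = x"
    using commuting_cubed[of ?z "twist d c ?q"] twist_cubed[OF a] twist_cubed[OF aq] by simp
qed

text \<open>The acting element must also fix \<open>e\<close>. The twist does so if \<open>e\<close>
  commutes with \<open>p\<close>; otherwise the map of \<open>twist_commuting\<close> takes its
  place.\<close>

lemma three_dvd_opp_commuting:
  assumes a: "aff d c p" and e: "\<not> adj e d" "\<not> adj e c"
  shows "3 dvd card (opp d c \<inter> {g. \<not> adj e g})"
proof -
  have fin: "finite (opp d c \<inter> {g. \<not> adj e g})" by simp
  show ?thesis
  proof (cases "adj e p")
  case False
  let ?z = "twist d c p"
  have "?z e = e"
    using False e adj_sym by (simp add: twist_def shift_def)
  then have iffs: "adj (?z g) d \<longleftrightarrow> adj g d" "adj (?z g) c \<longleftrightarrow> adj g c"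
    "adj e (?z g) \<longleftrightarrow> adj e g" "?z g = d \<longleftrightarrow> g = d" for g
    using twist_fixes[OF a]
    by (metis adj_twist, metis adj_twist, metis adj_twist, metis twist_eq_iff)
  show ?thesis
    by (rule three_dvd_card[OF fin, where h = ?z])
      (use iffs twist_moves[OF a] twist_cubed[OF a] in \<open>auto simp: opp_def\<close>)
next
  case True
  let ?z = "twist d c p"
  define y where "y = (\<lambda>x. ?z (r e (?z (r e x))))"
  have y: "y d = d" "y c = c" "y e = e" "y (y (y x)) = x" for x
    unfolding y_def by (rule twist_commuting[OF a e True])+
  have y_adj: "adj (y u) (y v) \<longleftrightarrow> adj u v" and y_eq: "y u = y v \<longleftrightarrow> u = v" for u v
    by (simp_all add: y_def)
  have iffs: "adj (y g) d \<longleftrightarrow> adj g d" "adj (y g) c \<longleftrightarrow> adj g c"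
    "adj e (y g) \<longleftrightarrow> adj e g" "y g = d \<longleftrightarrow> g = d" for g
    using y by (metis y_adj, metis y_adj, metis y_adj, metis y_eq)
  \<comment> \<open>A fixed point makes \<open>e\<close>, \<open>?g1\<close>, \<open>?g2\<close> a
    line. Some point \<open>x\<close> of the plane is adjacent to \<open>e\<close> but not to
    \<open>g\<close>; as the twist fixes \<open>x\<close>, it is adjacent to neither
    \<open>?g1\<close> nor \<open>?g2\<close>, hence not to \<open>e\<close>.\<close>
  have "y g \<noteq> g" if g: "g \<noteq> d" "\<not> adj g d" "adj g c" "\<not> adj e g" for g
  proof
    assume yg: "y g = g"
    let ?g1 = "?z g" and ?g2 = "?z (?z g)"
    have zg: "?z ?g2 = g" by (rule twist_cubed[OF a])
    have "?z (r e ?g1) = ?z ?g2" using yg g(4) zg by (simp add: y_def)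
    then have e1: "r e ?g1 = ?g2" by simp
    have mv: "?z g \<noteq> g" by (rule twist_moves[OF a g(2,1,3)])
    then have eg1: "adj e ?g1" unfolding adj_def e1 by simp
    have "adj ?g1 ?g2" using adj_line(2)[OF eg1] unfolding e1 .
    have "r ?g1 e = ?g2" using r_adj[OF eg1] unfolding e1 by simp
    then have "r ?g1 ?g2 = e" by (metis r_r)
    have adj_g: "adj g ?g1" using \<open>adj ?g1 ?g2\<close> by simp
    have r: "r c e = e" "r (r d c) e = e" using e not_adj_third[OF e] adj_sym by auto
    have "adj e (r c p)" "adj e (r (r d c) p)"
      using True r by (simp_all add: adj_r_left[symmetric])
    moreover have "?z (r c p) = r c p" "?z (r (r d c) p) = r (r d c) p"
      by (simp_all only: twist_r twist_fixes[OF a])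
    \<comment> \<open>Adjacency to all three points would keep \<open>g\<close> from being adjacent
      to its image under the twist, against \<open>adj_g\<close>.\<close>
    moreover have "\<not> (adj g p \<and> adj g (r c p) \<and> adj g (r (r d c) p))"
      using twist_moves_off_point(2)[OF a g(2,1,3)] adj_g by blast
    ultimately have "\<exists>x. \<not> adj g x \<and> ?z x = x \<and> adj e x"
      using True twist_fixes[OF a] by blast
    then obtain x where x: "\<not> adj g x" "?z x = x" "adj e x" by blast
    have "\<not> adj x ?g1" "\<not> adj x ?g2" using x by (metis adj_twist adj_sym)+
    then have "\<not> adj x e" using not_adj_third \<open>r ?g1 ?g2 = e\<close> by metis
    then show False using x adj_sym by blast
  qed
  then show ?thesis
    by (intro three_dvd_card[OF fin, where h = y]) (use iffs y(4) in \<open>auto simp: opp_def\<close>)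
qed

qed

section \<open>Affine planes through an edge, and residues of the counts\<close>

lemma aff_r [simp]: "aff (r g d) (r g c) (r g p) \<longleftrightarrow> aff d c p"
  by (simp add: aff_def r_dist[of g d c, symmetric])

text \<open>If \<open>c\<close> is adjacent to the whole line through \<open>d\<close> and
  \<open>x\<close>, or through \<open>d\<close> and \<open>y\<close>, that line and \<open>c\<close>
  span a plane. Otherwise \<open>c\<close> misses a point \<open>x'\<close> of the first and
  \<open>y'\<close> of the second. Then \<open>c\<close> is fixed by \<open>shift x' y'\<close>, and
  the orbit of \<open>d\<close> under this shift is a line all of whose points are adjacent to
  \<open>c\<close>.\<close>

lemma aff_edge:
  assumes "aff d x y" "adj d c"
  shows "\<exists>p. aff d c p"
proof (cases "(adj c x \<and> adj c (r d x)) \<or> (adj c y \<and> adj c (r d y))")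
  case True
  then have "aff d x c \<or> aff d y c"
    using assms adj_sym by (auto simp: aff_def)
  then show ?thesis using aff_swap by blast
next
  case False
  obtain x' where x': "\<not> adj c x'" "aff d x' y"
  proof (cases "adj c x")
    case True
    then show ?thesis using False that[of "r d x"] aff_swap aff_reflect assms(1) by blast
  qed (use that assms(1) in blast)
  obtain y' where y': "\<not> adj c y'" "aff d x' y'"
  proof (cases "adj c y")
    case True
    then show ?thesis using False that[of "r d y"] aff_reflect x'(2) by blast
  qed (use that x'(2) in blast)
  let ?s = "shift x' y'"
  have a: "aff x' y' d" using y'(2) by (rule aff_rotate)
  have "r x' c = c" "r y' c = c" using x'(1) y'(1) adj_sym by auto
  then have "adj (?s z) c \<longleftrightarrow> adj z c" for z by (simp add: shift_def adj_r_left)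
  then have "adj (?s d) c" "adj (?s (?s d)) c" using assms(2) by auto
  then have "aff d (?s d) c"
    using r_shift_fixed[OF a] assms(2) adj_sym by (auto simp: aff_def)
  then show ?thesis using aff_swap by blast
qed

lemma mod_three:
  fixes a b :: nat
  shows "3 dvd a \<Longrightarrow> 3 dvd b \<Longrightarrow> (2 + 2 * a + b) mod 3 = 2"
    "3 dvd a \<Longrightarrow> (b + 1 + a) mod 3 = 2 \<Longrightarrow> b mod 3 = 1"
    "a mod 3 = 2 \<Longrightarrow> (b + a) mod 3 = 2 \<Longrightarrow> b mod 3 = 0"
  by presburger+

lemma card_nbrs_aff:
  assumes "aff d c p"
  shows "card (nbrs c) mod 3 = 2"
proof -
  have dc: "adj d c" using assms by (simp add: aff_def)
  show ?thesis
    using card_nbrs_closed[of UNIV d c] three_dvd_aff[of UNIV d c] three_dvd_opp[OF assms] dc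
      mod_three(1) by simp
qed

lemma card_common_aff:
  assumes "aff d c p"
  shows "card (nbrs d \<inter> nbrs c) mod 3 = 1"
  using card_nbrs_aff[OF assms] card_common_adj[of d c] three_dvd_opp[OF assms] assms
    mod_three(2) by (simp add: aff_def)

lemma card_nbrs_commuting_aff:
  assumes "aff d c p" "\<not> adj e d" "\<not> adj e c"
  shows "card (nbrs c \<inter> {g. \<not> adj e g}) mod 3 = 2"
proof -
  let ?Q = "{g. \<not> adj e g}"
  have dc: "d \<in> ?Q" "c \<in> ?Q" "adj d c" using assms by (auto simp: aff_def)
  have Q: "r x y \<in> ?Q" if "x \<in> ?Q" "y \<in> ?Q" for x y
    using not_adj_third[of e x y] that by simp
  have "card (nbrs c \<inter> ?Q) = 2 + 2 * card (opp d c \<inter> ?Q) + card ({g. aff d c g} \<inter> ?Q)"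
    by (rule card_nbrs_closed) (use Q dc in auto)
  moreover have "3 dvd card ({g. aff d c g} \<inter> ?Q)"
    by (rule three_dvd_aff) (use Q dc in auto)
  ultimately show ?thesis
    using mod_three(1)[OF three_dvd_opp_commuting[OF assms]] by simp
qed

end

subsection \<open>Connected quandles\<close>

text \<open>\<open>nontrivial\<close> excludes an isolated point: its neighbourhood is empty, so the
  kernel equations would not constrain its class sum.\<close>

locale connected_reflection_quandle = reflection_quandle +
  assumes connected: "x \<in> D \<Longrightarrow> y \<in> D \<Longrightarrow> adj\<^sup>*\<^sup>* x y"
    and nontrivial: "\<exists>x y. adj x y"
begin

lemma card_nbrs_const:
  assumes "x \<in> D" "y \<in> D"
  shows "card (nbrs x) = card (nbrs y)"
  using connected[OF assms] by induction (auto dest: card_nbrs_adj)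

lemma ex_nbr:
  assumes "x \<in> D"
  shows "\<exists>y. adj x y"
proof -
  obtain a b where "adj a b" using nontrivial by blast
  moreover from connected[OF assms adj_D(1)[OF this]] have "x = a \<or> (\<exists>y. adj x y)"
    by (meson converse_rtranclpE)
  ultimately show ?thesis by blast
qed

text \<open>The diameter is at most 2. Walking along a path, let \<open>u\<close> be adjacent to
  \<open>x\<close> and \<open>y\<close> but not to the next point \<open>z\<close>, with
  \<open>x\<close> and \<open>y\<close> not adjacent; then \<open>r u y\<close> is adjacent to
  \<open>x\<close> and \<open>z\<close>.\<close>

lemma common_nbr:
  assumes "x \<in> D" "y \<in> D" "\<not> adj x y"
  shows "\<exists>u. adj u x \<and> adj u y"
proof -
  have "adj x y \<or> (\<exists>u. adj u x \<and> adj u y)"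
    using connected[OF assms(1,2)]
  proof induction
    case base
    then show ?case using ex_nbr[OF assms(1)] adj_sym by blast
  next
    case (step y z)
    show ?case
    proof (cases "adj x y")
      case True
      then show ?thesis using step adj_sym by blast
    next
      case False
      then obtain u where u: "adj u x" "adj u y" using step by blast
      show ?thesis
      proof (cases "adj u z")
        case False
        have "adj x (r u y)" using adj_third[OF u(2)] u(1) \<open>\<not> adj x y\<close> adj_sym by blast
        moreover have "adj z (r u y)"
          using adj_third[of y u z] u(2) step(2) False r_adj[OF u(2)] adj_sym by auto
        ultimately show ?thesis using adj_sym by blast
      qed (use u in blast)
    qed
  qed
  with assms(3) show ?thesis by blast
qed

text \<open>Reflection in the third point of a line exchanges the other two, so planes can be
  carried along edges.\<close>

lemma ex_aff:
  assumes "aff a b p" "d \<in> D"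
  shows "\<exists>c p. aff d c p"
proof -
  have "a \<in> D" using assms(1) adj_D by (auto simp: aff_def)
  from connected[OF this assms(2)] show ?thesis
  proof induction
    case base
    then show ?case using assms(1) by blast
  next
    case (step y z)
    then obtain c p where "aff y c p" by blast
    then have "aff (r (r y z) y) (r (r y z) c) (r (r y z) p)" by simp
    then show ?case using r_line[OF step(2)] by auto
  qed
qed

lemma aff_adj:
  assumes "aff a b p" "adj d c"
  shows "\<exists>p. aff d c p"
  using ex_aff[OF assms(1) adj_D(1)[OF assms(2)]] aff_edge[OF _ assms(2)] by blast

lemma ex_separating_nbr:
  assumes "x \<in> D" "y \<in> D" "nbrs x \<noteq> nbrs y"
  shows "\<exists>u. adj x u \<and> \<not> adj y u"
proof (rule ccontr)
  assume "\<not> ?thesis"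
  then have "nbrs x \<subseteq> nbrs y" by auto
  then show False
    using card_subset_eq[OF finite_nbrs, of "nbrs x" y] card_nbrs_const[OF assms(1,2)] assms(3) by simp
qed

text \<open>A point \<open>c\<close> adjacent to \<open>d\<close> but not to \<open>e\<close>
  provides the plane. The valency and the number of neighbours of \<open>d\<close> commuting with
  \<open>e\<close> are then both 2 modulo 3, and the count is their difference.\<close>

lemma card_common_commuting_aff:
  assumes a: "aff a b p" and de: "d \<in> D" "e \<in> D" "\<not> adj d e" "nbrs d \<noteq> nbrs e"
  shows "card (nbrs d \<inter> nbrs e) mod 3 = 0"
proof -
  obtain c where c: "adj d c" "\<not> adj e c" using ex_separating_nbr de by blast
  then obtain p where p: "aff c d p" using aff_adj[OF a] adj_sym by blast
  have "\<not> adj e d" using de(3) adj_sym by blast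
  from card_nbrs_commuting_aff[OF p c(2) this] card_nbrs_aff[OF p]
  have "card (nbrs d \<inter> {g. \<not> adj e g}) mod 3 = 2" "card (nbrs d) mod 3 = 2" by auto
  moreover have "card (nbrs d) = card (nbrs d \<inter> nbrs e) + card (nbrs d \<inter> {g. \<not> adj e g})"
  proof -
    have "card ((nbrs d \<inter> nbrs e) \<union> (nbrs d \<inter> {g. \<not> adj e g}))
        = card (nbrs d \<inter> nbrs e) + card (nbrs d \<inter> {g. \<not> adj e g})"
      by (rule card_Un_disjoint) auto
    moreover have "(nbrs d \<inter> nbrs e) \<union> (nbrs d \<inter> {g. \<not> adj e g}) = nbrs d" by auto
    ultimately show ?thesis by simp
  qed
  ultimately show ?thesis
    using mod_three(3)[of "card (nbrs d \<inter> {g. \<not> adj e g})" "card (nbrs d \<inter> nbrs e)"] by metis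
qed

subsection \<open>Quandles without affine planes\<close>

lemma card_common_adj_no_aff:
  assumes "\<nexists>d c p. aff d c p" "adj d c"
  shows "2 * card (nbrs d \<inter> nbrs c) = card (nbrs c)"
proof -
  have "{g. aff d c g} = {}" using assms(1) by blast
  then show ?thesis
    using card_nbrs_closed[of UNIV d c] card_common_adj[OF assms(2)] assms(2) by simp
qed

text \<open>With three adjacencies excluded, \<open>w\<close> is adjacent to 0 or 2 points of the
  line: adjacency behaves like a symplectic form over the field with two elements.\<close>

lemma adj_third_iff:
  assumes "\<nexists>d c p. aff d c p" "adj u v"
  shows "adj (r u v) w \<longleftrightarrow> adj u w \<noteq> adj v w"
proof -
  have "\<not> (adj w u \<and> adj w v \<and> adj w (r u v))" using assms by (auto simp: aff_def)
  moreover have "adj w (r u v)" if "adj w u" "\<not> adj w v"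
    by (rule adj_third[OF assms(2) that])
  moreover have "adj w (r u v)" if "adj w v" "\<not> adj w u"
    using adj_third[of v u w] that assms(2) adj_sym r_adj[OF assms(2)] by simp
  moreover have "\<not> adj w (r u v)" if "\<not> adj w u" "\<not> adj w v"
    by (rule not_adj_third[OF that])
  ultimately show ?thesis using adj_sym by blast
qed

text \<open>Reflection in \<open>r e x\<close> exchanges \<open>e\<close> and \<open>x\<close>, and
  it fixes \<open>d\<close>, which commutes with both.\<close>

lemma card_common_step:
  assumes "adj e x" "\<not> adj d e" "\<not> adj d x"
  shows "card (nbrs d \<inter> nbrs e) = card (nbrs d \<inter> nbrs x)"
proof -
  have "\<not> adj (r e x) d" using not_adj_third[OF assms(2,3)] adj_sym by blast
  then have "r (r e x) d = d" by simp
  then show ?thesis using card_common_r[of "r e x" d e] r_line[OF assms(1)] by simp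
qed

lemma ex_commuting_common_nbr:
  assumes no_aff: "\<nexists>d c p. aff d c p"
    and D: "d \<in> D" "e \<in> D" "e' \<in> D" and n: "\<not> adj d e" "\<not> adj d e'" "\<not> adj e e'"
    and ne: "nbrs d \<noteq> nbrs e" "nbrs d \<noteq> nbrs e'"
  shows "\<exists>t. adj e t \<and> adj e' t \<and> \<not> adj d t"
proof (rule ccontr)
  assume none: "\<not> ?thesis"
  note third = adj_third_iff[OF no_aff]
  obtain x where x: "adj x e" "adj x e'" using common_nbr[OF D(2,3) n(3)] by blast
  then have xd: "adj x d" using none adj_sym by blast
  \<comment> \<open>If a neighbour \<open>c\<close> of \<open>f\<close> commuting with
    \<open>d\<close> is adjacent to \<open>x\<close>, then \<open>r f c\<close> serves instead: its
    adjacency to \<open>x\<close> is 1 + 1 modulo 2.\<close>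
  have ex: "\<exists>c. adj c f \<and> \<not> adj c d \<and> \<not> adj c x"
    if f: "f \<in> D" "\<not> adj d f" "nbrs d \<noteq> nbrs f" "adj x f" for f
  proof -
    obtain c where c: "adj f c" "\<not> adj d c" using ex_separating_nbr[of f d] f D(1) by blast
    show ?thesis
    proof (cases "adj c x")
      case True
      have "adj (r f c) f" using adj_line(1)[OF c(1)] adj_sym by blast
      moreover have "\<not> adj (r f c) d" "\<not> adj (r f c) x"
        using third[OF c(1)] c f True adj_sym by blast+
      ultimately show ?thesis by blast
    qed (use c adj_sym in blast)
  qed
  obtain c where c: "adj c e" "\<not> adj c d" "\<not> adj c x" using ex[of e] D n ne x by blast
  obtain c' where c': "adj c' e'" "\<not> adj c' d" "\<not> adj c' x" using ex[of e'] D n ne x by blast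
  have ce': "\<not> adj c e'" "\<not> adj c' e" using c c' none adj_sym by blast+
  have cc': "\<not> adj c c'"
  proof
    assume cc: "adj c c'"
    have "adj (r c c') e" "adj (r c c') e'" "\<not> adj (r c c') d"
      using third[OF cc] c c' ce' by auto
    then show False using none adj_sym by blast
  qed
  note known = x xd c c' ce' cc' n
  have sym: "adj e x" "adj e' x" "adj d x" "adj e c" "\<not> adj d c" "\<not> adj x c" "adj e' c'"
    "\<not> adj d c'" "\<not> adj x c'" "\<not> adj e' c" "\<not> adj e c'" "\<not> adj c' c" "\<not> adj e d"
    "\<not> adj e' d" "\<not> adj e' e"
    using known adj_sym by blast+
  txt \<open>Without affine planes adjacency is additive modulo 2 along lines, so \<open>u6\<close> below has
    the adjacencies of \<open>e + e' + d + c + c'\<close>; passing through \<open>x\<close>, which cancels,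
    makes the two points adjacent at each step.\<close>
  define u1 where "u1 = r e x"
  have u1: "adj u1 w \<longleftrightarrow> adj e w \<noteq> adj x w" for w unfolding u1_def by (rule third) (rule sym)
  define u2 where "u2 = r e' u1"
  have "adj e' u1" using u1 known sym adj_sym by blast
  then have u2: "adj u2 w \<longleftrightarrow> adj e' w \<noteq> adj u1 w" for w unfolding u2_def by (rule third)
  define u3 where "u3 = r d u2"
  have "adj u2 d" unfolding u2 u1 using known sym by simp
  then have "adj d u2" using adj_sym by blast
  then have u3: "adj u3 w \<longleftrightarrow> adj d w \<noteq> adj u2 w" for w unfolding u3_def by (rule third)
  define u4 where "u4 = r x u3"
  have "adj u3 x" unfolding u3 u2 u1 using known sym by simp
  then have "adj x u3" using adj_sym by blast
  then have u4: "adj u4 w \<longleftrightarrow> adj x w \<noteq> adj u3 w" for w unfolding u4_def by (rule third)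
  define u5 where "u5 = r c u4"
  have "adj u4 c" unfolding u4 u3 u2 u1 using known sym by simp
  then have "adj c u4" using adj_sym by blast
  then have u5: "adj u5 w \<longleftrightarrow> adj c w \<noteq> adj u4 w" for w unfolding u5_def by (rule third)
  define u6 where "u6 = r c' u5"
  have "adj u5 c'" unfolding u5 u4 u3 u2 u1 using known sym by simp
  then have "adj c' u5" using adj_sym by blast
  then have u6: "adj u6 w \<longleftrightarrow> adj c' w \<noteq> adj u5 w" for w unfolding u6_def by (rule third)
  have "adj u6 e" "adj u6 e'" "\<not> adj u6 d"
    unfolding u6 u5 u4 u3 u2 u1 using known sym by simp_all
  then show False using none adj_sym by blast
qed

text \<open>The points \<open>e\<close> and \<open>e'\<close> are joined by a path of at most two
  edges among points commuting with \<open>d\<close>, and \<open>card_common_step\<close> keeps the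
  count along each edge.\<close>

lemma card_common_const_no_aff:
  assumes no_aff: "\<nexists>d c p. aff d c p"
    and D: "d \<in> D" "e \<in> D" "e' \<in> D" and n: "\<not> adj d e" "\<not> adj d e'"
    and ne: "nbrs d \<noteq> nbrs e" "nbrs d \<noteq> nbrs e'"
  shows "card (nbrs d \<inter> nbrs e) = card (nbrs d \<inter> nbrs e')"
proof (cases "adj e e'")
  case True
  then show ?thesis using card_common_step n by blast
next
  case False
  then obtain t where "adj e t" "adj e' t" "\<not> adj d t"
    using ex_commuting_common_nbr[OF no_aff D n _ ne] by blast
  then show ?thesis using card_common_step[of e t d] card_common_step[of e' t d] n by simp
qed

end

section \<open>The kernel of the adjacency matrix\<close>

text \<open>The matrix is invertible modulo 3, so its determinant is a nonzero integer and stays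
  nonzero in characteristic 0. The proof is Gaussian elimination with pivot \<open>N k k\<close>,
  carried out without division so that \<open>N'\<close> remains integral and inherits both
  congruence conditions.\<close>

lemma three_unimodular_kernel:
  fixes N :: "'i \<Rightarrow> 'i \<Rightarrow> int" and w :: "'i \<Rightarrow> 'f::field_char_0"
  assumes "finite I" "\<And>i. i \<in> I \<Longrightarrow> \<not> 3 dvd N i i"
    "\<And>i j. i \<in> I \<Longrightarrow> j \<in> I \<Longrightarrow> i \<noteq> j \<Longrightarrow> 3 dvd N i j"
    "\<And>i. i \<in> I \<Longrightarrow> (\<Sum>j\<in>I. of_int (N i j) * w j) = 0" "i \<in> I"
  shows "w i = 0"
  using assms
proof (induction I arbitrary: N i rule: finite_induct)
  case (insert k I)
  define N' where "N' = (\<lambda>i j. N k k * N i j - N i k * N k j)"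
  have row: "of_int (N i k) * w k + (\<Sum>j\<in>I. of_int (N i j) * w j) = 0" if "i \<in> insert k I" for i
    using insert.prems(3)[OF that] insert.hyps by simp
  have w: "w i = 0" if i: "i \<in> I" for i
  proof (rule insert.IH[of N'])
    fix i assume i: "i \<in> I"
    then have "i \<noteq> k" using insert.hyps by blast
    then have "3 dvd N i k * N k i" using insert.prems(2)[of i k] i by simp
    moreover have "\<not> 3 dvd N k k * N i i"
      using i insert.prems(1)[of i] insert.prems(1)[of k]
      by (simp add: prime_dvd_mult_iff)
    ultimately show "\<not> 3 dvd N' i i" 
      using dvd_add[of 3 "N' i i" "N i k * N k i"] by (auto simp: N'_def)
    have "(\<Sum>j\<in>I. of_int (N' i j) * w j)
        = of_int (N k k) * (\<Sum>j\<in>I. of_int (N i j) * w j)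
          - of_int (N i k) * (\<Sum>j\<in>I. of_int (N k j) * w j)"
      by (simp add: N'_def sum_distrib_left sum_subtractf algebra_simps)
    moreover have "(\<Sum>j\<in>I. of_int (N i j) * w j) = - (of_int (N i k) * w k)"
      "(\<Sum>j\<in>I. of_int (N k j) * w j) = - (of_int (N k k) * w k)"
      using row[of i] row[of k] i by (simp_all add: add_eq_0_iff)
    ultimately show "(\<Sum>j\<in>I. of_int (N' i j) * w j) = 0" by simp
  next
    fix i j assume "i \<in> I" "j \<in> I" "i \<noteq> j"
    then have "3 dvd N i j" "3 dvd N i k" using insert.prems(2)[of i j] insert.prems(2)[of i k] insert.hyps by auto
    then show "3 dvd N' i j" by (simp add: N'_def)
  qed (rule i)
  have "of_int (N k k) * w k = 0" using row[of k] w by simp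
  moreover have "N k k \<noteq> 0" using insert.prems(1)[of k] by auto
  ultimately have "w k = 0" by simp
  with w insert.prems(4) show ?case by blast
qed simp

section \<open>Class sums of a vector in the kernel\<close>

context connected_reflection_quandle
begin

text \<open>Row \<open>x\<close> of \<open>A (A v) = 0\<close> with the summations
  exchanged.\<close>

lemma sum_card_common:
  fixes v :: "'a \<Rightarrow> 'f::field_char_0"
  assumes "\<And>x. x \<in> D \<Longrightarrow> sum v (nbrs x) = 0" and x: "x \<in> D"
  shows "(\<Sum>y\<in>D. of_nat (card (nbrs x \<inter> nbrs y)) * v y) = 0"
proof -
  have D: "nbrs y \<subseteq> D" for y by (auto dest: adj_D)
  have "(\<Sum>z\<in>nbrs x. sum v (nbrs z)) = 0"
    by (intro sum.neutral ballI assms(1)) (use D in blast)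
  then have "0 = (\<Sum>z\<in>nbrs x. sum v (nbrs z))" by simp
  also have "\<dots> = (\<Sum>z\<in>nbrs x. \<Sum>y | y \<in> D \<and> y \<in> nbrs z. v y)"
    using D by (intro sum.cong refl arg_cong[where f = "sum v"]) auto
  also have "\<dots> = (\<Sum>y\<in>D. \<Sum>z | z \<in> nbrs x \<and> y \<in> nbrs z. v y)"
    by (rule sum.swap_restrict) (auto simp: finite_D)
  also have "\<dots> = (\<Sum>y\<in>D. of_nat (card (nbrs x \<inter> nbrs y)) * v y)"
  proof (rule sum.cong[OF refl])
    fix y
    have "{z. z \<in> nbrs x \<and> y \<in> nbrs z} = nbrs x \<inter> nbrs y" using adj_sym by auto
    then show "(\<Sum>z | z \<in> nbrs x \<and> y \<in> nbrs z. v y) = of_nat (card (nbrs x \<inter> nbrs y)) * v y" by simp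
  qed
  finally show ?thesis by simp
qed

text \<open>The graph is regular of positive valency, so adding up all kernel equations gives the
  valency times \<open>sum v D\<close>.\<close>

lemma sum_kernel:
  fixes v :: "'a \<Rightarrow> 'f::field_char_0"
  assumes "\<And>x. x \<in> D \<Longrightarrow> sum v (nbrs x) = 0"
  shows "sum v D = 0"
proof -
  obtain a where a: "a \<in> D" using nontrivial adj_D by blast
  have D: "nbrs y \<subseteq> D" for y by (auto dest: adj_D)
  have "0 = (\<Sum>x\<in>D. sum v (nbrs x))" using assms by simp
  also have "\<dots> = (\<Sum>x\<in>D. \<Sum>y | y \<in> D \<and> y \<in> nbrs x. v y)"
    using D by (intro sum.cong refl arg_cong[where f = "sum v"]) auto
  also have "\<dots> = (\<Sum>y\<in>D. \<Sum>x | x \<in> D \<and> y \<in> nbrs x. v y)"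
    by (rule sum.swap_restrict) (auto simp: finite_D)
  also have "\<dots> = (\<Sum>y\<in>D. of_nat (card (nbrs a)) * v y)"
  proof (rule sum.cong[OF refl])
    fix y assume y: "y \<in> D"
    have "{x. x \<in> D \<and> y \<in> nbrs x} = nbrs y" using adj_sym adj_D by auto
    then show "(\<Sum>x | x \<in> D \<and> y \<in> nbrs x. v y) = of_nat (card (nbrs a)) * v y"
      using card_nbrs_const[OF a y] by simp
  qed
  finally have "of_nat (card (nbrs a)) * sum v D = 0" by (simp add: sum_distrib_left)
  moreover have "nbrs a \<noteq> {}" using ex_nbr[OF a] by auto
  ultimately show ?thesis by simp
qed

lemma not_adj_twin: "nbrs x = nbrs y \<Longrightarrow> \<not> adj x y"
  by (metis mem_nbrs not_adj_self)

lemma class_sum_no_aff: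
  fixes v :: "'a \<Rightarrow> 'f::field_char_0"
  assumes no_aff: "\<nexists>d c p. aff d c p"
    and ker: "\<And>x. x \<in> D \<Longrightarrow> sum v (nbrs x) = 0" and x: "x \<in> D"
  shows "(\<Sum>y | y \<in> D \<and> nbrs y = nbrs x. v y) = 0"
proof -
  let ?T = "{y. y \<in> D \<and> nbrs y = nbrs x}"
  let ?k = "card (nbrs x)"
  \<comment> \<open>A neighbour of \<open>x\<close> that is not a neighbour of \<open>e\<close>
    makes the common count smaller than the valency. If no point \<open>e\<close> of this kind
    exists, 0 is taken as \<open>m\<close>.\<close>
  obtain m where m: "m < ?k"
    "\<And>y. y \<in> D \<Longrightarrow> \<not> adj x y \<Longrightarrow> nbrs y \<noteq> nbrs x \<Longrightarrow> card (nbrs x \<inter> nbrs y) = m"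
  proof (cases "\<exists>e. e \<in> D \<and> \<not> adj x e \<and> nbrs e \<noteq> nbrs x")
    case True
    then obtain e where e: "e \<in> D" "\<not> adj x e" "nbrs x \<noteq> nbrs e" by metis
    obtain u where "adj x u" "\<not> adj e u" using ex_separating_nbr[OF x e(1,3)] by blast
    then have "nbrs x \<inter> nbrs e \<subset> nbrs x" by auto
    then have "card (nbrs x \<inter> nbrs e) < ?k" by (simp add: psubset_card_mono)
    then show ?thesis
      using that card_common_const_no_aff[OF no_aff x _ e(1) _ e(2) _ e(3)] by metis
  next
    case False
    have "nbrs x \<noteq> {}" using ex_nbr[OF x] by auto
    then show ?thesis using False by (intro that[of 0]) (auto simp: card_gt_0_iff)
  qed
  have sub: "nbrs x \<subseteq> D" "?T \<subseteq> D - nbrs x"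
    using not_adj_twin[of x] by (auto dest: adj_D)
  let ?f = "\<lambda>y. of_nat (card (nbrs x \<inter> nbrs y)) * v y"
  \<comment> \<open>The row is doubled because adjacent points share half the valency. Both
    \<open>v\<close> on \<open>nbrs x\<close> and \<open>v\<close> on \<open>D\<close> sum to 0, so
    the remaining points contribute minus the class sum, and the factor \<open>2 * (k - m)\<close>
    is left.\<close>
  have "0 = 2 * sum ?f D" using sum_card_common[OF ker x] by simp
  also have "sum ?f D = sum ?f (nbrs x) + sum ?f ?T + sum ?f (D - nbrs x - ?T)"
    using sum.subset_diff[OF sub(1) finite_D, of ?f] sum.subset_diff[OF sub(2), of ?f] finite_D
    by (simp add: add.commute add.left_commute)
  also have "2 * \<dots> = of_nat ?k * sum v (nbrs x) + 2 * of_nat ?k * sum v ?T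
      + 2 * of_nat m * sum v (D - nbrs x - ?T)"
  proof -
    have eq: "2 * ?f y = of_nat ?k * v y" if "y \<in> nbrs x" for y
    proof -
      have "2 * card (nbrs x \<inter> nbrs y) = ?k"
        using card_common_adj_no_aff[OF no_aff, of x y] card_nbrs_adj[of x y] that by simp
      then have "(of_nat ?k :: 'f) = 2 * of_nat (card (nbrs x \<inter> nbrs y))" by (metis of_nat_mult of_nat_numeral)
      then show ?thesis by simp
    qed
    have "2 * sum ?f (nbrs x) = of_nat ?k * sum v (nbrs x)"
      unfolding sum_distrib_left by (rule sum.cong[OF refl eq])
    moreover have "sum ?f ?T = of_nat ?k * sum v ?T" by (simp add: sum_distrib_left)
    moreover have "sum ?f (D - nbrs x - ?T) = of_nat m * sum v (D - nbrs x - ?T)"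
      using m(2) by (simp add: sum_distrib_left)
    ultimately show ?thesis by (simp add: distrib_left mult.assoc)
  qed
  also have "sum v (D - nbrs x - ?T) = - sum v ?T"
    using sum.subset_diff[OF sub(1) finite_D, of v] sum.subset_diff[OF sub(2), of v] finite_D
      sum_kernel[OF ker] ker[OF x] by (simp add: add_eq_0_iff2)
  finally have E: "0 = of_nat ?k * sum v (nbrs x) + 2 * of_nat ?k * sum v ?T
      + 2 * of_nat m * (- sum v ?T)" .
  have "2 * (of_nat ?k - of_nat m) * sum v ?T = of_nat ?k * sum v (nbrs x)
      + 2 * of_nat ?k * sum v ?T + 2 * of_nat m * (- sum v ?T)"
    using ker[OF x] by (simp add: algebra_simps)
  then have "2 * (of_nat ?k - of_nat m) * sum v ?T = 0" unfolding E[symmetric] .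
  moreover have "of_nat ?k - of_nat m \<noteq> (0 :: 'f)" using m(1) by simp
  ultimately show ?thesis by (metis mult_eq_0_iff zero_neq_numeral)
qed

lemma class_sum_aff:
  fixes v :: "'a \<Rightarrow> 'f::field_char_0"
  assumes a: "aff a b p"
    and ker: "\<And>x. x \<in> D \<Longrightarrow> sum v (nbrs x) = 0" and x: "x \<in> D"
  shows "(\<Sum>y | y \<in> D \<and> nbrs y = nbrs x. v y) = 0"
proof -
  \<comment> \<open>The twin classes are indexed by their neighbourhoods. Adjacency depends on the
    classes only, so any representatives may witness it. Subtracting it turns the residue 1 of
    adjacent classes into 0.\<close>
  define N where "N = (\<lambda>S T. int (card (S \<inter> T)) - (if \<exists>x y. nbrs x = S \<and> nbrs y = T \<and> adj x y then 1 else 0))"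
  define w where "w = (\<lambda>S. \<Sum>y | y \<in> D \<and> nbrs y = S. v y)"
  have N: "N (nbrs x) (nbrs y) = int (card (nbrs x \<inter> nbrs y)) - (if adj x y then 1 else 0)" for x y
  proof -
    have "adj x y \<longleftrightarrow> adj x' y'" if "nbrs x' = nbrs x" "nbrs y' = nbrs y" for x' y'
    proof -
      have "adj x y \<longleftrightarrow> adj x' y" using that(1) by (metis mem_nbrs)
      also have "\<dots> \<longleftrightarrow> adj y x'" by (rule adj_sym)
      also have "\<dots> \<longleftrightarrow> adj y' x'" using that(2) by (metis mem_nbrs)
      also have "\<dots> \<longleftrightarrow> adj x' y'" by (rule adj_sym)
      finally show ?thesis .
    qed
    then have "(\<exists>x' y'. nbrs x' = nbrs x \<and> nbrs y' = nbrs y \<and> adj x' y') \<longleftrightarrow> adj x y" by blast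
    then show ?thesis by (simp add: N_def)
  qed
  have "w (nbrs x) = 0"
  proof (rule three_unimodular_kernel[where N = N and I = "nbrs ` D"])
    fix S assume "S \<in> nbrs ` D"
    then obtain y where y: "y \<in> D" "S = nbrs y" by blast
    obtain q c where "aff y q c" using ex_aff[OF a y(1)] by blast
    then have "card (nbrs y) mod 3 = 2" using card_nbrs_aff aff_rotate by blast
    then show "\<not> 3 dvd N S S" unfolding y(2) N by simp presburger
    have "(\<Sum>T\<in>nbrs ` D. of_int (N S T) * w T)
        = (\<Sum>T\<in>nbrs ` D. \<Sum>z | z \<in> D \<and> nbrs z = T. of_int (N S (nbrs z)) * v z)"
      unfolding w_def sum_distrib_left by (intro sum.cong refl) auto
    also have "\<dots> = (\<Sum>z\<in>D. of_int (N S (nbrs z)) * v z)"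
      by (rule sum.image_gen[symmetric]) (rule finite_D)
    also have "\<dots> = (\<Sum>z\<in>D. of_nat (card (nbrs y \<inter> nbrs z)) * v z - (if z \<in> nbrs y then v z else 0))"
      unfolding y(2) N by (intro sum.cong refl) (simp add: left_diff_distrib)
    also have "\<dots> = - (\<Sum>z\<in>D. if z \<in> nbrs y then v z else 0)"
      using sum_card_common[OF ker y(1)] by (simp add: sum_subtractf)
    also have "\<dots> = - sum v (D \<inter> nbrs y)" by (subst sum.inter_restrict) (auto simp: finite_D)
    also have "D \<inter> nbrs y = nbrs y" by (auto dest: adj_D)
    finally show "(\<Sum>T\<in>nbrs ` D. of_int (N S T) * w T) = 0" using ker[OF y(1)] by simp
  next
    fix S T assume "S \<in> nbrs ` D" "T \<in> nbrs ` D" "S \<noteq> T"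
    then obtain y z where yz: "y \<in> D" "S = nbrs y" "z \<in> D" "T = nbrs z" "nbrs y \<noteq> nbrs z" by blast
    show "3 dvd N S T"
    proof (cases "adj y z")
      case True
      then obtain q where "aff y z q" using aff_adj[OF a] by blast
      then have "card (nbrs y \<inter> nbrs z) mod 3 = 1" by (rule card_common_aff)
      then show ?thesis using True unfolding yz N by simp presburger
    next
      case False
      then have "card (nbrs y \<inter> nbrs z) mod 3 = 0"
        by (intro card_common_commuting_aff[OF a yz(1,3) _ yz(5)])
      then have "int 3 dvd int (card (nbrs y \<inter> nbrs z))"
        unfolding int_dvd_int_iff by (rule mod_0_imp_dvd)
      then show ?thesis using False unfolding yz N by simp
    qed
  qed (use finite_D x in auto)
  then show ?thesis by (simp add: w_def)
qed

theorem class_sum_eq_0: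
  fixes v :: "'a \<Rightarrow> 'f::field_char_0"
  assumes "\<And>x. x \<in> D \<Longrightarrow> sum v (nbrs x) = 0" and "x \<in> D"
  shows "(\<Sum>y | y \<in> D \<and> nbrs y = nbrs x. v y) = 0"
  using class_sum_aff[of _ _ _ v x] class_sum_no_aff[of v x] assms by blast

end

section \<open>Eigenspaces of collinearity maps\<close>

lemma fscale_apply [simp]: "fscale c v x = c * v x"
  by (simp add: fscale_def)

lemma sum_fun_apply [simp]: "(\<Sum>i\<in>I. f i) x = (\<Sum>i\<in>I. f i x)"
  by (induction I rule: infinite_finite_induct) auto

text \<open>The evaluations at the points \<open>p j\<close> are dual to the family
  \<open>b\<close>, which is therefore independent.\<close>

lemma dim_coordinates:
  fixes b :: "'i \<Rightarrow> 'a \<Rightarrow> 'f::field"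
  assumes I: "finite I"
    and b: "\<And>i j. i \<in> I \<Longrightarrow> j \<in> I \<Longrightarrow> b i (p j) = (if i = j then 1 else 0)"
    and V: "b ` I \<subseteq> V" "V \<subseteq> fun_space.span (b ` I)"
  shows "fun_space.dim V = card I"
proof (rule fun_space.dim_unique[OF V])
  have inj: "inj_on b I"
    by (rule inj_onI) (metis b zero_neq_one)
  then show "card (b ` I) = card I" by (rule card_image)
  show "fun_space.independent (b ` I)"
  proof
    assume "fun_space.dependent (b ` I)"
    then obtain u i where i: "i \<in> I" "u (b i) \<noteq> 0" and u: "(\<Sum>v\<in>b ` I. fscale (u v) v) = 0"
      using I by (auto simp: fun_space.dependent_finite)
    have "0 = (\<Sum>v\<in>b ` I. fscale (u v) v) (p i)" by (simp add: u)
    also have "\<dots> = (\<Sum>j\<in>I. u (b j) * b j (p i))" by (simp add: sum.reindex[OF inj])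
    also have "\<dots> = (\<Sum>j\<in>I. if j = i then u (b i) else 0)"
      using b i by (intro sum.cong) auto
    also have "\<dots> = u (b i)" using i I by simp
    finally show False using i by simp
  qed
qed

lemma matsuo_space_eq:
  assumes "finite D"
  shows "matsuo_space \<eta> D = {v. \<forall>x. x \<notin> D \<longrightarrow> v x = 0}"
proof (rule equalityI)
  show "matsuo_space \<eta> D \<subseteq> {v. \<forall>x. x \<notin> D \<longrightarrow> v x = 0}"
    unfolding matsuo_space_def
    by (rule fun_space.span_minimal) (auto simp: basis_vec_def fun_space.subspace_def)
  show "{v. \<forall>x. x \<notin> D \<longrightarrow> v x = 0} \<subseteq> matsuo_space \<eta> D"
  proof (rule subsetI, unfold matsuo_space_def)
    fix v :: "'a \<Rightarrow> 'f::field" assume v: "v \<in> {v. \<forall>x. x \<notin> D \<longrightarrow> v x = 0}"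
    have "v = (\<Sum>d\<in>D. fscale (v d) (basis_vec d))"
    proof
      fix x
      have "(\<Sum>d\<in>D. v d * basis_vec d x) = (\<Sum>d\<in>D. if x = d then v d else 0)"
        by (intro sum.cong) (auto simp: basis_vec_def)
      then show "v x = (\<Sum>d\<in>D. fscale (v d) (basis_vec d)) x"
        using v assms by auto
    qed
    moreover have "(\<Sum>d\<in>D. fscale (v d) (basis_vec d)) \<in> fun_space.span (basis_vec ` D)"
      by (intro fun_space.span_sum fun_space.span_scale fun_space.span_base) auto
    ultimately show "v \<in> fun_space.span (basis_vec ` D)" by metis
  qed
qed

lemma dim_matsuo_space:
  assumes "finite D"
  shows "fun_space.dim (matsuo_space \<eta> D) = card D"
  by (rule dim_coordinates[where b = basis_vec and p = id])
    (use assms in \<open>auto simp: basis_vec_def matsuo_space_def intro: fun_space.span_base\<close>)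

text \<open>The definition spreads \<open>v d\<close> over the neighbours of \<open>d\<close>;
  symmetry turns this into a sum gathered at \<open>x\<close>, the form of the kernel
  equations.\<close>

lemma collinearity_map_apply:
  assumes "finite D" "\<And>c d. c \<in> D \<Longrightarrow> d \<in> D \<Longrightarrow> c \<in> collinear_set G D d \<longleftrightarrow> d \<in> collinear_set G D c"
  shows "collinearity_map G D v x = (if x \<in> D then sum v (collinear_set G D x) else 0)"
proof -
  have sub: "collinear_set G D d \<subseteq> D" for d by (auto simp: collinear_set_def)
  have fin: "finite (collinear_set G D d)" for d using sub assms(1) by (rule finite_subset)
  have "collinearity_map G D v x = (\<Sum>d\<in>D. v d * (\<Sum>c\<in>collinear_set G D d. if x = c then 1 else 0))"
    by (simp add: collinearity_map_def basis_vec_def)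
  also have "\<dots> = (\<Sum>d\<in>D. if x \<in> collinear_set G D d then v d else 0)"
    using fin by (intro sum.cong) auto
  also have "\<dots> = (\<Sum>d\<in>D \<inter> {d. x \<in> collinear_set G D d}. v d)"
    using assms(1) by (subst sum.inter_restrict) auto
  also have "\<dots> = (if x \<in> D then sum v (collinear_set G D x) else 0)"
  proof (cases "x \<in> D")
    case True
    then have "D \<inter> {d. x \<in> collinear_set G D d} = collinear_set G D x"
      using assms(2) sub by blast
    then show ?thesis using True by simp
  next
    case False
    then have "D \<inter> {d. x \<in> collinear_set G D d} = {}" using sub by blast
    then show ?thesis using False by simp
  qed
  finally show ?thesis .
qed

lemma dim_linear_image:
  fixes f :: "('a \<Rightarrow> 'f::field) \<Rightarrow> ('b \<Rightarrow> 'f)"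
  assumes f: "module_hom fscale fscale f" and V: "fun_space.subspace V" and inj: "inj_on f V"
  shows "fun_space.dim (f ` V) = fun_space.dim V"
proof -
  obtain B where B: "B \<subseteq> V" "fun_space.independent B" "V \<subseteq> fun_space.span B"
    "card B = fun_space.dim V"
    using fun_space.basis_exists by blast
  have span: "fun_space.span B = V" using B V fun_space.span_minimal by blast
  show ?thesis
  proof (rule fun_space.dim_unique)
    show "f ` B \<subseteq> f ` V" using B by blast
    show "f ` V \<subseteq> fun_space.span (f ` B)"
      by (simp add: module_hom.span_image[OF f] span)
    show "fun_space.independent (f ` B)"
      using module_hom.independent_injective_image[OF f B(2)] inj span by simp
    show "card (f ` B) = fun_space.dim V"
      using B inj by (metis card_image inj_on_subset)
  qed
qed

text \<open>What the linear algebra takes from the group: fibres of one size, and adjacency that can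
  be read off from the images. The fibres will be the twin classes.\<close>

locale collinearity_blowup =
  fixes G :: "('a, 'c) monoid_scheme" and D :: "'a set"
    and G' :: "('b, 'd) monoid_scheme" and D' :: "'b set"
    and \<pi> :: "'a \<Rightarrow> 'b" and n :: nat
  assumes finite_D: "finite D"
    and image: "\<pi> ` D = D'"
    and n_pos: "n > 0"
    and card_fibre: "d \<in> D \<Longrightarrow> card {e \<in> D. \<pi> e = \<pi> d} = n"
    and sym: "c \<in> D \<Longrightarrow> d \<in> D \<Longrightarrow> c \<in> collinear_set G D d \<longleftrightarrow> d \<in> collinear_set G D c"
    and lift: "d \<in> D \<Longrightarrow> e \<in> D \<Longrightarrow> \<pi> e \<in> collinear_set G' D' (\<pi> d) \<longleftrightarrow> e \<in> collinear_set G D d"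
begin

lemma finite_D': "finite D'"
  using image finite_D by blast

lemma sub: "collinear_set G D d \<subseteq> D" "collinear_set G' D' y \<subseteq> D'"
  by (auto simp: collinear_set_def)

lemma sym':
  assumes "y \<in> D'" "z \<in> D'"
  shows "y \<in> collinear_set G' D' z \<longleftrightarrow> z \<in> collinear_set G' D' y"
proof -
  obtain c d where "c \<in> D" "d \<in> D" "y = \<pi> c" "z = \<pi> d" using assms image by blast
  then show ?thesis using lift sym by simp
qed

lemma map_apply: "collinearity_map G D v x = (if x \<in> D then sum v (collinear_set G D x) else 0)"
  by (rule collinearity_map_apply[OF finite_D]) (rule sym)

lemma map_apply':
  "collinearity_map G' D' v y = (if y \<in> D' then sum v (collinear_set G' D' y) else 0)"
  by (rule collinearity_map_apply[OF finite_D']) (rule sym')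

lemma card_D: "card D = n * card D'"
proof -
  have "card D = (\<Sum>y\<in>\<pi> ` D. \<Sum>x | x \<in> D \<and> \<pi> x = y. 1)"
    using sum.image_gen[OF finite_D, of "\<lambda>_. 1::nat" \<pi>] by simp
  also have "\<dots> = (\<Sum>y\<in>\<pi> ` D. n)" using card_fibre by (intro sum.cong) auto
  finally show ?thesis by (simp add: image)
qed

lemma collinear_fibre:
  assumes d: "d \<in> D" and e: "e \<in> collinear_set G D d"
  shows "{x \<in> collinear_set G D d. \<pi> x = \<pi> e} = {x \<in> D. \<pi> x = \<pi> e}"
proof -
  have "e \<in> D" using e sub by blast
  then have "x \<in> collinear_set G D d" if "x \<in> D" "\<pi> x = \<pi> e" for x
    using lift[OF d, of e] lift[OF d that(1)] that(2) e by simp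
  then show ?thesis using sub by blast
qed

lemma sum_pullback:
  fixes v :: "'b \<Rightarrow> 'f::field_char_0"
  assumes d: "d \<in> D"
  shows "(\<Sum>x\<in>collinear_set G D d. v (\<pi> x)) = of_nat n * sum v (collinear_set G' D' (\<pi> d))"
proof -
  have fin: "finite (collinear_set G D d)" using sub finite_D finite_subset by blast
  have im: "\<pi> ` collinear_set G D d = collinear_set G' D' (\<pi> d)"
  proof (intro equalityI subsetI)
    fix y assume "y \<in> \<pi> ` collinear_set G D d"
    then obtain e where "e \<in> collinear_set G D d" "y = \<pi> e" by blast
    then show "y \<in> collinear_set G' D' (\<pi> d)" using lift[OF d, of e] sub(1) by blast
  next
    fix y assume y: "y \<in> collinear_set G' D' (\<pi> d)"
    then obtain e where "e \<in> D" "y = \<pi> e" using sub(2) image by blast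
    then show "y \<in> \<pi> ` collinear_set G D d" using lift[OF d, of e] y by blast
  qed
  have "(\<Sum>x\<in>collinear_set G D d. v (\<pi> x))
      = (\<Sum>y\<in>\<pi> ` collinear_set G D d. \<Sum>x | x \<in> collinear_set G D d \<and> \<pi> x = y. v (\<pi> x))"
    by (rule sum.image_gen[OF fin])
  also have "\<dots> = (\<Sum>y\<in>\<pi> ` collinear_set G D d. of_nat n * v y)"
  proof (rule sum.cong[OF refl])
    fix y assume "y \<in> \<pi> ` collinear_set G D d"
    then obtain e where e: "e \<in> collinear_set G D d" "y = \<pi> e" by blast
    then have "e \<in> D" using sub by blast
    have "{x. x \<in> collinear_set G D d \<and> \<pi> x = y} = {x \<in> D. \<pi> x = \<pi> e}"
      using collinear_fibre[OF d e(1)] e(2) by simp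
    then show "(\<Sum>x | x \<in> collinear_set G D d \<and> \<pi> x = y. v (\<pi> x)) = of_nat n * v y"
      using card_fibre[OF \<open>e \<in> D\<close>] e(2) by simp
  qed
  finally show ?thesis by (simp add: im sum_distrib_left)
qed

text \<open>Eigenvectors travel against the projection, as functions constant on fibres; this
  embedding intertwines the lower map, scaled by \<open>n\<close>, with the upper one.\<close>

definition pullback :: "('b \<Rightarrow> 'f::field_char_0) \<Rightarrow> 'a \<Rightarrow> 'f"
  where "pullback v = (\<lambda>x. if x \<in> D then v (\<pi> x) else 0)"

lemma pullback_hom: "module_hom fscale fscale pullback"
  unfolding module_hom_def module_hom_axioms_def
  by (auto simp: fun_space.module_axioms pullback_def fun_eq_iff)

lemma pullback_inj:
  fixes \<eta> :: "'f::field_char_0"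
  shows "inj_on pullback (matsuo_space \<eta> D')"
proof (rule inj_onI, rule ext)
  fix v w :: "'b \<Rightarrow> 'f" and y
  assume vw: "v \<in> matsuo_space \<eta> D'" "w \<in> matsuo_space \<eta> D'" and eq: "pullback v = pullback w"
  show "v y = w y"
  proof (cases "y \<in> D'")
    case True
    then obtain x where x: "x \<in> D" "y = \<pi> x" using image by blast
    then show ?thesis using fun_cong[OF eq, of x] by (simp add: pullback_def)
  next
    case False
    then show ?thesis using vw by (simp add: matsuo_space_eq[OF finite_D'])
  qed
qed

lemma collinearity_map_pullback:
  "collinearity_map G D (pullback v) = fscale (of_nat n) (pullback (collinearity_map G' D' v))"
proof
  fix x
  have "sum (pullback v) (collinear_set G D x) = (\<Sum>e\<in>collinear_set G D x. v (\<pi> e))"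
    using sub by (intro sum.cong) (auto simp: pullback_def)
  then show "collinearity_map G D (pullback v) x
      = fscale (of_nat n) (pullback (collinearity_map G' D' v)) x"
    using sum_pullback[of x v] image by (auto simp: map_apply map_apply' pullback_def)
qed

text \<open>For \<open>\<rho> \<noteq> 0\<close> an eigenvector is a multiple of its image, and
  images are constant on fibres because the points of a fibre have equal neighbourhoods.\<close>

lemma pullback_eigenspace:
  fixes \<rho> :: "'f::field_char_0"
  assumes "\<rho> \<noteq> 0"
  shows "pullback ` eigenspace_on (matsuo_space \<eta> D') (collinearity_map G' D') (\<rho> / of_nat n)
    = eigenspace_on (matsuo_space \<eta> D) (collinearity_map G D) \<rho>"
proof (intro equalityI subsetI)
  fix v :: "'a \<Rightarrow> 'f"
  assume "v \<in> pullback ` eigenspace_on (matsuo_space \<eta> D') (collinearity_map G' D') (\<rho> / of_nat n)"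
  then obtain w where w: "collinearity_map G' D' w = fscale (\<rho> / of_nat n) w" "v = pullback w"
    by (auto simp: eigenspace_on_def)
  have "collinearity_map G D v = fscale \<rho> v"
    unfolding w(2) collinearity_map_pullback w(1) using n_pos by (auto simp: pullback_def fun_eq_iff)
  then show "v \<in> eigenspace_on (matsuo_space \<eta> D) (collinearity_map G D) \<rho>"
    by (simp add: eigenspace_on_def matsuo_space_eq[OF finite_D] w(2) pullback_def)
next
  fix v :: "'a \<Rightarrow> 'f"
  assume v: "v \<in> eigenspace_on (matsuo_space \<eta> D) (collinearity_map G D) \<rho>"
  then have ev: "\<rho> * v x = sum v (collinear_set G D x)" if "x \<in> D" for x
    using map_apply[of v x] that by (simp add: eigenspace_on_def)
  have v0: "v x = 0" if "x \<notin> D" for x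
    using v that by (simp add: eigenspace_on_def matsuo_space_eq[OF finite_D])
  have const: "v x = v y" if xy: "x \<in> D" "y \<in> D" "\<pi> x = \<pi> y" for x y
  proof -
    have "collinear_set G D x = collinear_set G D y"
    proof (rule Set.set_eqI)
      fix z
      show "z \<in> collinear_set G D x \<longleftrightarrow> z \<in> collinear_set G D y"
        using lift[OF xy(1), of z] lift[OF xy(2), of z] xy(3) sub(1) by (cases "z \<in> D") auto
    qed
    then have "\<rho> * v x = \<rho> * v y" using ev xy by simp
    then show ?thesis using assms by simp
  qed
  define w where "w = (\<lambda>y. if y \<in> D' then v (SOME x. x \<in> D \<and> \<pi> x = y) else 0)"
  have w: "w (\<pi> x) = v x" if x: "x \<in> D" for x
  proof -
    let ?z = "SOME z. z \<in> D \<and> \<pi> z = \<pi> x"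
    have "?z \<in> D \<and> \<pi> ?z = \<pi> x"
      by (rule someI[of _ x]) (use x in simp)
    moreover have "\<pi> x \<in> D'" using x image by blast
    ultimately show ?thesis using const[of ?z x] x by (simp add: w_def)
  qed
  have wM: "w \<in> matsuo_space \<eta> D'" by (simp add: matsuo_space_eq[OF finite_D'] w_def)
  have pw: "pullback w = v" using w v0 by (auto simp: pullback_def)
  have "collinearity_map G' D' w = fscale (\<rho> / of_nat n) w"
  proof
    fix y
    show "collinearity_map G' D' w y = fscale (\<rho> / of_nat n) w y"
    proof (cases "y \<in> D'")
      case True
      then obtain x where x: "x \<in> D" "y = \<pi> x" using image by blast
      have "\<rho> * v x = sum (\<lambda>z. w (\<pi> z)) (collinear_set G D x)"
        unfolding ev[OF x(1)] by (intro sum.cong refl w[symmetric]) (use sub(1) in blast)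
      also have "\<dots> = of_nat n * sum w (collinear_set G' D' y)"
        using sum_pullback[OF x(1)] x(2) by simp
      finally show ?thesis using True n_pos w[OF x(1)] x(2) by (simp add: map_apply' field_simps)
    qed (simp add: map_apply' w_def)
  qed
  then show "v \<in> pullback ` eigenspace_on (matsuo_space \<eta> D') (collinearity_map G' D') (\<rho> / of_nat n)"
    using wM pw by (auto simp: eigenspace_on_def)
qed

lemma subspace_eigenspace:
  "fun_space.subspace (eigenspace_on (matsuo_space \<eta> D') (collinearity_map G' D') \<rho>)"
  unfolding fun_space.subspace_def
  by (auto simp: eigenspace_on_def matsuo_space_eq[OF finite_D'] fun_eq_iff map_apply'
      sum.distrib algebra_simps sum_distrib_left[symmetric])

lemma nonzero_eigenvalue:
  fixes \<rho> :: "'f::field_char_0"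
  assumes "\<rho> \<noteq> 0" "eigenvalue_on (matsuo_space \<eta> D) (collinearity_map G D) \<rho>"
  shows "eigenvalue_on (matsuo_space \<eta> D') (collinearity_map G' D') (\<rho> / of_nat n)"
    and "multiplicity_on (matsuo_space \<eta> D) (collinearity_map G D) \<rho>
      = multiplicity_on (matsuo_space \<eta> D') (collinearity_map G' D') (\<rho> / of_nat n)"
proof -
  let ?E' = "eigenspace_on (matsuo_space \<eta> D') (collinearity_map G' D') (\<rho> / of_nat n)"
  note eq = pullback_eigenspace[OF assms(1), of \<eta>]
  obtain w where "w \<in> ?E'" "pullback w \<noteq> 0"
    using assms(2) unfolding eigenvalue_on_def eq[symmetric] by blast
  moreover have "pullback (0 :: 'b \<Rightarrow> 'f) = 0" by (auto simp: pullback_def)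
  with \<open>pullback w \<noteq> 0\<close> have "w \<noteq> 0" by metis
  ultimately show "eigenvalue_on (matsuo_space \<eta> D') (collinearity_map G' D') (\<rho> / of_nat n)"
    unfolding eigenvalue_on_def by blast
  have "inj_on pullback ?E'"
    by (rule inj_on_subset[OF pullback_inj]) (auto simp: eigenspace_on_def)
  from dim_linear_image[OF pullback_hom subspace_eigenspace this]
  show "multiplicity_on (matsuo_space \<eta> D) (collinearity_map G D) \<rho>
      = multiplicity_on (matsuo_space \<eta> D') (collinearity_map G' D') (\<rho> / of_nat n)"
    unfolding multiplicity_on_def eq by simp
qed

section \<open>Vectors with zero fibre sums: the kernel of the linear map induced by the
  projection\<close>

definition fibre_sum_zero :: "('a \<Rightarrow> 'f::field_char_0) set"
  where "fibre_sum_zero = {v. (\<forall>x. x \<notin> D \<longrightarrow> v x = 0) \<and> (\<forall>x\<in>D. (\<Sum>e | e \<in> D \<and> \<pi> e = \<pi> x. v e) = 0)}"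

definition rep :: "'a \<Rightarrow> 'a"
  where "rep x = (SOME z. z \<in> D \<and> \<pi> z = \<pi> x)"

lemma rep: "x \<in> D \<Longrightarrow> rep x \<in> D" "x \<in> D \<Longrightarrow> \<pi> (rep x) = \<pi> x"
  using someI[of "\<lambda>z. z \<in> D \<and> \<pi> z = \<pi> x" x] by (auto simp: rep_def)

lemma rep_cong: "\<pi> x = \<pi> y \<Longrightarrow> rep x = rep y"
  by (simp add: rep_def)

lemma card_reps: "card (rep ` D) = card D'"
proof -
  have "inj_on \<pi> (rep ` D)"
  proof (rule inj_onI)
    fix a b assume "a \<in> rep ` D" "b \<in> rep ` D" and eq: "\<pi> a = \<pi> b"
    then obtain x y where xy: "x \<in> D" "y \<in> D" "a = rep x" "b = rep y" by blast
    then have "\<pi> x = \<pi> y" using eq rep(2) by simp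
    then show "a = b" using xy rep_cong[of x y] by simp
  qed
  moreover have "\<pi> ` rep ` D = D'"
    using rep(2) unfolding image[symmetric] image_image by (rule image_cong[OF refl])
  ultimately show ?thesis using card_image by metis
qed

lemma subspace_fibre_sum_zero: "fun_space.subspace fibre_sum_zero"
  unfolding fun_space.subspace_def
  by (auto simp: fibre_sum_zero_def sum.distrib sum_distrib_left[symmetric])

lemma difference_mem_fibre_sum_zero:
  assumes "c \<in> D" "d \<in> D" "\<pi> c = \<pi> d"
  shows "(basis_vec c - basis_vec d :: 'a \<Rightarrow> 'f::field_char_0) \<in> fibre_sum_zero"
proof -
  have "(\<Sum>e | e \<in> D \<and> \<pi> e = \<pi> x. (basis_vec c - basis_vec d) e :: 'f) = 0" for x
    using assms finite_D by (simp add: basis_vec_def sum_subtractf)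
  then show ?thesis using assms by (auto simp: fibre_sum_zero_def basis_vec_def)
qed

text \<open>The coordinates off the representatives determine \<open>v\<close>, as a zero fibre sum
  recovers the remaining one.\<close>

lemma fibre_sum_zero_expansion:
  assumes v: "v \<in> fibre_sum_zero"
  shows "v = (\<Sum>c\<in>D - rep ` D. fscale (v c) (basis_vec c - basis_vec (rep c)))"
proof
  fix x
  let ?I = "D - rep ` D"
  have "(\<Sum>c\<in>?I. fscale (v c) (basis_vec c - basis_vec (rep c))) x
      = (\<Sum>c\<in>?I. if c = x then v c else 0) - (\<Sum>c\<in>?I. if rep c = x then v c else 0)"
    by (simp add: basis_vec_def sum_subtractf[symmetric]) (intro sum.cong; auto)
  also have "\<dots> = (if x \<in> ?I then v x else 0) - sum v {c \<in> ?I. rep c = x}"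
  proof -
    have "(\<Sum>c\<in>?I. if rep c = x then v c else 0) = sum v {c \<in> ?I. rep c = x}"
      by (rule sum.inter_filter[symmetric]) (use finite_D in simp)
    moreover have "(\<Sum>c\<in>?I. if c = x then v c else 0) = (if x \<in> ?I then v x else 0)"
      using finite_D by (intro sum.delta) simp
    ultimately show ?thesis by (simp only:)
  qed
  also have "\<dots> = v x"
  proof (cases "x \<in> rep ` D")
    case True
    then obtain d where d: "d \<in> D" "x = rep d" by blast
    then have x: "x \<in> D" "rep x = x" using rep[of d] rep_cong[of "rep d" d] by auto
    have "{e. e \<in> D \<and> \<pi> e = \<pi> x} = insert x {c \<in> ?I. rep c = x}"
    proof -
      have "rep e = x \<longleftrightarrow> \<pi> e = \<pi> x" if "e \<in> D" for e
        using rep[OF that] rep_cong[of e x] x by metis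
      moreover have "e = x" if e: "e \<in> rep ` D" "\<pi> e = \<pi> x" for e
      proof -
        obtain y where y: "y \<in> D" "e = rep y" using e(1) by blast
        then have "\<pi> y = \<pi> x" using rep(2)[OF y(1)] e(2) by simp
        then show ?thesis using rep_cong[of y x] y x by simp
      qed
      ultimately show ?thesis using x by auto
    qed
    moreover have "(\<Sum>e | e \<in> D \<and> \<pi> e = \<pi> x. v e) = 0" using v x by (simp add: fibre_sum_zero_def)
    ultimately have "v x + sum v {c \<in> ?I. rep c = x} = 0"
      using True finite_D by simp
    then show ?thesis using True by (simp add: add_eq_0_iff)
  next
    case False
    then have empty: "{c \<in> ?I. rep c = x} = {}" by auto
    show ?thesis unfolding empty using False v by (auto simp: fibre_sum_zero_def)
  qed
  finally show "v x = (\<Sum>c\<in>?I. fscale (v c) (basis_vec c - basis_vec (rep c))) x" by simp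
qed

lemma dim_fibre_sum_zero: "fun_space.dim (fibre_sum_zero :: ('a \<Rightarrow> 'f::field_char_0) set) = card D - card D'"
proof -
  let ?I = "D - rep ` D"
  let ?b = "\<lambda>c. basis_vec c - basis_vec (rep c) :: 'a \<Rightarrow> 'f"
  have "fun_space.dim (fibre_sum_zero :: ('a \<Rightarrow> 'f) set) = card ?I"
  proof (rule dim_coordinates[where b = ?b and p = id])
    show "?b ` ?I \<subseteq> fibre_sum_zero"
      by (intro image_subsetI difference_mem_fibre_sum_zero) (use rep in auto)
    show "fibre_sum_zero \<subseteq> fun_space.span (?b ` ?I)"
    proof
      fix v :: "'a \<Rightarrow> 'f" assume v: "v \<in> fibre_sum_zero"
      have "(\<Sum>c\<in>?I. fscale (v c) (?b c)) \<in> fun_space.span (?b ` ?I)"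
        by (intro fun_space.span_sum fun_space.span_scale fun_space.span_base) auto
      then show "v \<in> fun_space.span (?b ` ?I)" using fibre_sum_zero_expansion[OF v] by simp
    qed
  qed (use finite_D in \<open>auto simp: basis_vec_def\<close>)
  also have "\<dots> = card D - card D'"
    using rep(1) finite_D by (subst card_Diff_subset) (auto simp: card_reps)
  finally show ?thesis .
qed

lemma tau_difference_space_eq:
  assumes "\<And>c d. c \<in> D \<Longrightarrow> d \<in> D \<Longrightarrow> tau_rel G D c d \<longleftrightarrow> \<pi> c = \<pi> d"
  shows "tau_difference_space G D = fibre_sum_zero"
proof (rule equalityI)
  show "tau_difference_space G D \<subseteq> fibre_sum_zero"
    unfolding tau_difference_space_def
    by (rule fun_space.span_minimal[OF _ subspace_fibre_sum_zero])
      (use assms difference_mem_fibre_sum_zero in auto)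
  show "fibre_sum_zero \<subseteq> tau_difference_space G D"
  proof
    fix v :: "'a \<Rightarrow> 'f::field_char_0" assume v: "v \<in> fibre_sum_zero"
    have "(\<Sum>c\<in>D - rep ` D. fscale (v c) (basis_vec c - basis_vec (rep c))) \<in> tau_difference_space G D"
      unfolding tau_difference_space_def
    proof (intro fun_space.span_sum fun_space.span_scale fun_space.span_base)
      fix c assume "c \<in> D - rep ` D"
      then have "c \<in> D" "rep c \<in> D" "tau_rel G D c (rep c)" using assms rep by auto
      then show "basis_vec c - basis_vec (rep c) \<in>
        {basis_vec c - basis_vec d |c d. c \<in> D \<and> d \<in> D \<and> tau_rel G D c d}" by blast
    qed
    then show "v \<in> tau_difference_space G D" using fibre_sum_zero_expansion[OF v] by simp
  qed
qed

text \<open>The hypothesis supplies the hard inclusion; the other holds because neighbourhoods are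
  unions of fibres.\<close>

lemma eigenspace_zero:
  assumes ker: "\<And>(v :: 'a \<Rightarrow> 'f::field_char_0) x. (\<And>x. x \<in> D \<Longrightarrow> sum v (collinear_set G D x) = 0) \<Longrightarrow> x \<in> D
      \<Longrightarrow> (\<Sum>e | e \<in> D \<and> \<pi> e = \<pi> x. v e) = 0"
  shows "eigenspace_on (matsuo_space \<eta> D) (collinearity_map G D) (0 :: 'f) = fibre_sum_zero"
proof (intro equalityI subsetI)
  fix v :: "'a \<Rightarrow> 'f"
  assume v: "v \<in> eigenspace_on (matsuo_space \<eta> D) (collinearity_map G D) 0"
  have "sum v (collinear_set G D x) = 0" if "x \<in> D" for x
  proof -
    have "collinearity_map G D v x = 0" using v by (simp add: eigenspace_on_def)
    then show ?thesis using that by (simp add: map_apply)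
  qed
  then show "v \<in> fibre_sum_zero"
    using v ker by (auto simp: fibre_sum_zero_def eigenspace_on_def matsuo_space_eq[OF finite_D])
next
  fix v :: "'a \<Rightarrow> 'f"
  assume v: "v \<in> fibre_sum_zero"
  have "sum v (collinear_set G D d) = 0" if d: "d \<in> D" for d
  proof -
    have "sum v (collinear_set G D d)
      = (\<Sum>y\<in>\<pi> ` collinear_set G D d. \<Sum>x | x \<in> collinear_set G D d \<and> \<pi> x = y. v x)"
      by (rule sum.image_gen) (rule finite_subset[OF sub(1) finite_D])
    also have "\<dots> = 0"
    proof (rule sum.neutral, rule ballI)
      fix y assume "y \<in> \<pi> ` collinear_set G D d"
      then obtain e where e: "e \<in> collinear_set G D d" "y = \<pi> e" by blast
      then have "e \<in> D" using sub by blast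
      have "{x. x \<in> collinear_set G D d \<and> \<pi> x = y} = {x \<in> D. \<pi> x = \<pi> e}"
        using collinear_fibre[OF d e(1)] e(2) by simp
      then show "(\<Sum>x | x \<in> collinear_set G D d \<and> \<pi> x = y. v x) = 0"
        using v \<open>e \<in> D\<close> by (simp add: fibre_sum_zero_def)
    qed
    finally show ?thesis .
  qed
  then show "v \<in> eigenspace_on (matsuo_space \<eta> D) (collinearity_map G D) 0"
    using v by (auto simp: eigenspace_on_def matsuo_space_eq[OF finite_D] fibre_sum_zero_def
        map_apply fun_eq_iff)
qed

end

section \<open>The quandle of a 3-transposition group\<close>

context reflection_quandle
begin

lemma twin_r:
  assumes "nbrs x = nbrs y"
  shows "nbrs (r g x) = nbrs (r g y)"
proof (rule Set.set_eqI)
  fix z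
  have "r g z \<in> nbrs x \<longleftrightarrow> r g z \<in> nbrs y" using assms by simp
  then show "z \<in> nbrs (r g x) \<longleftrightarrow> z \<in> nbrs (r g y)" by (simp add: adj_r_left)
qed

text \<open>This makes the twin subgroup act trivially on twin classes. For \<open>c\<close>
  adjacent to \<open>e\<close>, replacing \<open>e\<close> by its twin \<open>d\<close> in
  \<open>r d (r c e)\<close> yields \<open>r d (r c d) = c\<close>.\<close>

lemma twin_translation:
  assumes "nbrs d = nbrs e"
  shows "nbrs (r d (r e c)) = nbrs c"
proof (cases "adj e c")
  case True
  have "c \<in> nbrs d" using True assms by simp
  then have dc: "adj d c" by simp
  have "nbrs (r d (r c e)) = nbrs (r d (r c d))"
    using twin_r[OF twin_r[OF assms]] by metis
  then show ?thesis using r_adj[OF True] r_adj[OF dc] r_r by metis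
next
  case False
  have "c \<notin> nbrs d" using False assms by simp
  then show ?thesis using False by simp
qed

end

section \<open>Products of order three and the reflections of the group\<close>

context three_transposition_group
begin

lemma D_carrier [simp]: "d \<in> D \<Longrightarrow> d \<in> carrier G"
  using D_subset by blast

lemma D_sq [simp]: "d \<in> D \<Longrightarrow> d \<otimes> d = \<one>"
  using pow_ord_eq_1[of d] D_involution[of d] by (simp add: numeral_2_eq_2)

lemma inv_D [simp]: "d \<in> D \<Longrightarrow> inv d = d"
  by (rule inv_equality) auto

lemma D_cancel [simp]: "d \<in> D \<Longrightarrow> y \<in> carrier G \<Longrightarrow> d \<otimes> (d \<otimes> y) = y"
  by (simp add: m_assoc[symmetric])

lemma conj_D: "d \<in> D \<Longrightarrow> x \<in> D \<Longrightarrow> d \<otimes> x \<otimes> d \<in> D"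
  using D_normal[of d x] by simp

lemma conj_eq_iff:
  assumes "d \<in> D" "e \<in> D"
  shows "d \<otimes> e \<otimes> d = e \<longleftrightarrow> (d \<otimes> e) [^] (2::nat) = \<one>"
proof -
  have sq: "(d \<otimes> e) [^] (2::nat) = (d \<otimes> e \<otimes> d) \<otimes> e"
    using assms by (simp add: numeral_2_eq_2 m_assoc)
  show ?thesis
    unfolding sq using assms inv_equality[of "d \<otimes> e \<otimes> d" e] by auto
qed

lemma ord_product_eq_3_iff:
  assumes "d \<in> D" "e \<in> D"
  shows "ord (d \<otimes> e) = 3 \<longleftrightarrow> d \<otimes> e \<otimes> d \<noteq> e"
proof -
  have c: "d \<otimes> e \<in> carrier G" using assms by simp
  \<comment> \<open>Finiteness excludes the value 0 that \<open>ord\<close> takes at elements of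
    infinite order, so 1, 2 and 3 remain.\<close>
  have "ord (d \<otimes> e) \<ge> 1" using ord_ge_1[OF finite_carrier c] .
  then consider "ord (d \<otimes> e) = 1" | "ord (d \<otimes> e) = 2" | "ord (d \<otimes> e) = 3"
    using D_product[OF assms] by linarith
  then show ?thesis
    unfolding conj_eq_iff[OF assms] pow_eq_id[OF c] by cases auto
qed

lemma conj_swap:
  assumes "d \<in> D" "e \<in> D" "d \<otimes> e \<otimes> d \<noteq> e"
  shows "d \<otimes> e \<otimes> d = e \<otimes> d \<otimes> e"
proof -
  have "ord (d \<otimes> e) = 3" using ord_product_eq_3_iff assms by simp
  then have "(d \<otimes> e) [^] (3::nat) = \<one>"
    using pow_ord_eq_1[of "d \<otimes> e"] assms(1,2) by (metis D_carrier m_closed)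
  then have "(d \<otimes> e \<otimes> d) \<otimes> (e \<otimes> d \<otimes> e) = \<one>"
    using assms by (simp add: numeral_3_eq_3 m_assoc)
  then have "inv (e \<otimes> d \<otimes> e) = d \<otimes> e \<otimes> d"
    using assms by (intro inv_equality) auto
  moreover have "inv (e \<otimes> d \<otimes> e) = e \<otimes> d \<otimes> e"
    using conj_D[OF assms(2,1)] by simp
  ultimately show ?thesis by simp
qed

definition reflect :: "'a \<Rightarrow> 'a \<Rightarrow> 'a"
  where "reflect d x = (if d \<in> D \<and> x \<in> D then d \<otimes> x \<otimes> d else x)"

lemma finite_D: "finite D"
  using D_subset finite_carrier by (rule finite_subset)

sublocale quandle: reflection_quandle D reflect
proof
  fix d e x
  show "finite D" by (rule finite_D)
  show "reflect d (reflect d x) = x"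
    by (simp add: reflect_def conj_D) (simp add: m_assoc)
  show "reflect d d = d" by (simp add: reflect_def)
  show "reflect d (reflect e x) = reflect (reflect d e) (reflect d x)"
    by (simp add: reflect_def conj_D) (auto simp: m_assoc)
  show "reflect d x = reflect x d" if "reflect d x \<noteq> x"
    using that conj_swap[of d x] by (auto simp: reflect_def split: if_splits)
  show "x \<in> D" if "reflect d x \<noteq> x"
    using that by (auto simp: reflect_def split: if_splits)
qed

lemma adj_iff: "quandle.adj d e \<longleftrightarrow> d \<in> D \<and> e \<in> D \<and> ord (d \<otimes> e) = 3"
  by (auto simp: quandle.adj_def reflect_def ord_product_eq_3_iff)

lemma collinear_set_eq: "d \<in> D \<Longrightarrow> collinear_set G D d = quandle.nbrs d"
  by (auto simp: collinear_set_def adj_iff)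

lemma tau_rel_iff: "d \<in> D \<Longrightarrow> e \<in> D \<Longrightarrow> tau_rel G D d e \<longleftrightarrow> quandle.nbrs d = quandle.nbrs e"
  by (simp add: tau_rel_def collinear_set_eq)

section \<open>Conjugation by group elements and the twin subgroup\<close>

lemma conj_mult:
  "g \<in> carrier G \<Longrightarrow> x \<in> carrier G \<Longrightarrow> y \<in> carrier G \<Longrightarrow>
    (g \<otimes> x \<otimes> inv g) \<otimes> (g \<otimes> y \<otimes> inv g) = g \<otimes> (x \<otimes> y) \<otimes> inv g"
  by (simp add: m_assoc) (simp add: m_assoc[symmetric])

lemma conj_comp:
  "g \<in> carrier G \<Longrightarrow> k \<in> carrier G \<Longrightarrow> x \<in> carrier G \<Longrightarrow>
    (g \<otimes> k) \<otimes> x \<otimes> inv (g \<otimes> k) = g \<otimes> (k \<otimes> x \<otimes> inv k) \<otimes> inv g"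
  by (simp add: m_assoc inv_mult_group)

lemma conj_cancel:
  "g \<in> carrier G \<Longrightarrow> x \<in> carrier G \<Longrightarrow> g \<otimes> (inv g \<otimes> x \<otimes> inv (inv g)) \<otimes> inv g = x"
  using conj_comp[of g "inv g" x] by simp

lemma conj_inject:
  "g \<in> carrier G \<Longrightarrow> x \<in> carrier G \<Longrightarrow> y \<in> carrier G \<Longrightarrow>
    g \<otimes> x \<otimes> inv g = g \<otimes> y \<otimes> inv g \<longleftrightarrow> x = y"
  by simp

lemma adj_conj:
  assumes "g \<in> carrier G" "d \<in> D" "c \<in> D"
  shows "quandle.adj (g \<otimes> d \<otimes> inv g) (g \<otimes> c \<otimes> inv g) \<longleftrightarrow> quandle.adj d c"
proof -
  let ?d = "g \<otimes> d \<otimes> inv g" and ?c = "g \<otimes> c \<otimes> inv g"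
  have D: "?d \<in> D" "?c \<in> D" using D_normal assms by auto
  have "?d \<otimes> ?c \<otimes> ?d = g \<otimes> (d \<otimes> c \<otimes> d) \<otimes> inv g"
    using assms by (simp only: conj_mult D_carrier m_closed)
  then have "?d \<otimes> ?c \<otimes> ?d = ?c \<longleftrightarrow> d \<otimes> c \<otimes> d = c"
    using conj_inject[of g "d \<otimes> c \<otimes> d" c] assms by (metis D_carrier m_closed)
  then show ?thesis
    unfolding adj_iff using ord_product_eq_3_iff D assms by metis
qed

lemma twin_conj:
  assumes g: "g \<in> carrier G" and de: "d \<in> D" "e \<in> D" and tw: "quandle.nbrs d = quandle.nbrs e"
  shows "quandle.nbrs (g \<otimes> d \<otimes> inv g) = quandle.nbrs (g \<otimes> e \<otimes> inv g)"
proof -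
  have "quandle.adj (g \<otimes> d \<otimes> inv g) z \<longleftrightarrow> quandle.adj (g \<otimes> e \<otimes> inv g) z" for z
  proof (cases "z \<in> D")
    case True
    define c where "c = inv g \<otimes> z \<otimes> inv (inv g)"
    have c: "c \<in> D" "z = g \<otimes> c \<otimes> inv g"
      unfolding c_def using True g D_normal[of "inv g" z] conj_cancel[of g z] by simp_all
    have "c \<in> quandle.nbrs d \<longleftrightarrow> c \<in> quandle.nbrs e" using tw by simp
    then show ?thesis unfolding c(2) using adj_conj g de c(1) by simp
  qed (simp add: adj_iff)
  then show ?thesis by auto
qed

abbreviation twin_products :: "'a set"
  where "twin_products \<equiv> {d \<otimes> e | d e. d \<in> D \<and> e \<in> D \<and> tau_rel G D d e}"

lemma twin_products_carrier: "twin_products \<subseteq> carrier G"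
  by auto

lemma tau_subgroup_normal: "tau_subgroup G D \<lhd> G"
  unfolding tau_subgroup_def
proof (rule normal_generateI[OF twin_products_carrier])
  fix h g assume "h \<in> twin_products" and g: "g \<in> carrier G"
  then obtain d e where h: "h = d \<otimes> e" "d \<in> D" "e \<in> D" "tau_rel G D d e" by blast
  have D: "g \<otimes> d \<otimes> inv g \<in> D" "g \<otimes> e \<otimes> inv g \<in> D" using D_normal g h by auto
  moreover have "tau_rel G D (g \<otimes> d \<otimes> inv g) (g \<otimes> e \<otimes> inv g)"
    using h twin_conj[OF g h(2,3)] by (simp add: tau_rel_iff D)
  moreover have "g \<otimes> h \<otimes> inv g = (g \<otimes> d \<otimes> inv g) \<otimes> (g \<otimes> e \<otimes> inv g)"
    using conj_mult[of g d e] g h by simp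
  ultimately show "g \<otimes> h \<otimes> inv g \<in> twin_products" by blast
qed

lemma tau_subgroup_subgroup: "subgroup (tau_subgroup G D) G"
  using tau_subgroup_normal by (rule normal_imp_subgroup)

lemma tau_subgroup_carrier: "t \<in> tau_subgroup G D \<Longrightarrow> t \<in> carrier G"
  using subgroup.mem_carrier[OF tau_subgroup_subgroup] .

lemma twin_conj_tau:
  assumes "t \<in> tau_subgroup G D" "c \<in> D"
  shows "quandle.nbrs (t \<otimes> c \<otimes> inv t) = quandle.nbrs c"
proof -
  have prod: "quandle.nbrs ((d \<otimes> e) \<otimes> c \<otimes> inv (d \<otimes> e)) = quandle.nbrs c"
    if "d \<in> D" "e \<in> D" "tau_rel G D d e" "c \<in> D" for d e c
  proof -
    have "(d \<otimes> e) \<otimes> c \<otimes> inv (d \<otimes> e) = reflect d (reflect e c)"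
      using that conj_comp[of d e c] by (simp add: reflect_def conj_D)
    then show ?thesis using quandle.twin_translation that by (simp add: tau_rel_iff)
  qed
  have "\<forall>c\<in>D. quandle.nbrs (t \<otimes> c \<otimes> inv t) = quandle.nbrs c"
    using assms(1) unfolding tau_subgroup_def
  proof (induction t rule: generate.induct)
    case one
    then show ?case by simp
  next
    case (incl h)
    then show ?case using prod by blast
  next
    case (inv h)
    then obtain d e where h: "h = d \<otimes> e" "d \<in> D" "e \<in> D" "tau_rel G D d e" by blast
    then have "inv h = e \<otimes> d" by (simp add: inv_mult_group)
    moreover have "tau_rel G D e d" using h(4) by (simp add: tau_rel_def)
    ultimately show ?case using prod h by metis
  next
    case (eng s t)
    then have st: "s \<in> carrier G" "t \<in> carrier G"
      using generate_in_carrier[OF twin_products_carrier] by auto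
    show ?case
    proof
      fix c assume c: "c \<in> D"
      have "quandle.nbrs (s \<otimes> (t \<otimes> c \<otimes> inv t) \<otimes> inv s) = quandle.nbrs (t \<otimes> c \<otimes> inv t)"
        using eng.IH(1) D_normal[OF st(2) c] by blast
      then show "quandle.nbrs (s \<otimes> t \<otimes> c \<otimes> inv (s \<otimes> t)) = quandle.nbrs c"
        using conj_comp[of s t c] st c eng.IH(2) by simp
    qed
  qed
  then show ?thesis using assms(2) by blast
qed

text \<open>If \<open>c\<close> is adjacent to \<open>e = dt\<close> but commutes with
  \<open>d\<close>, then \<open>reflect e c\<close> is the reflection in \<open>d\<close> of a twin
  of \<open>c\<close>, hence itself a twin of \<open>c\<close>; yet it is adjacent to
  \<open>c\<close>.\<close>

lemma nbrs_mult_tau: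
  assumes d: "d \<in> D" and e: "e \<in> D" and t: "t \<in> tau_subgroup G D" and eq: "e = d \<otimes> t"
  shows "quandle.nbrs e \<subseteq> quandle.nbrs d"
proof
  fix c assume "c \<in> quandle.nbrs e"
  then have ec: "quandle.adj e c" by simp
  then have c: "c \<in> D" by (simp add: adj_iff)
  note tc = tau_subgroup_carrier[OF t]
  show "c \<in> quandle.nbrs d"
  proof (rule ccontr)
    assume "c \<notin> quandle.nbrs d"
    then have dc: "reflect d c = c" by simp
    have tcD: "t \<otimes> c \<otimes> inv t \<in> D" using D_normal tc c .
    have "reflect e c = e \<otimes> c \<otimes> inv e" using e c by (simp add: reflect_def)
    also have "\<dots> = reflect d (t \<otimes> c \<otimes> inv t)"
      unfolding eq using conj_comp[of d t c] d tc c tcD by (simp add: reflect_def)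
    finally have "quandle.nbrs (reflect e c) = quandle.nbrs (reflect d c)"
      using quandle.twin_r[OF twin_conj_tau[OF t c]] by simp
    then have "quandle.nbrs (reflect e c) = quandle.nbrs c" by (simp only: dc)
    moreover have "reflect e c \<in> quandle.nbrs c" using quandle.adj_line(2)[OF ec] by simp
    ultimately show False by (metis quandle.mem_nbrs quandle.not_adj_self)
  qed
qed

section \<open>Fibres of the projection and orders in the quotient\<close>

abbreviation proj :: "'a \<Rightarrow> 'a set"
  where "proj d \<equiv> tau_subgroup G D #> d"

lemma mem_l_coset_iff:
  assumes "d \<in> D" "e \<in> D"
  shows "e \<in> d <# tau_subgroup G D \<longleftrightarrow> proj e = proj d"
proof -
  have "d <# tau_subgroup G D = proj d"
    using tau_subgroup_normal assms by (simp add: normal.coset_eq)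
  then show ?thesis
    using repr_independence[of e _ d] repr_independenceD[of _ e d] tau_subgroup_subgroup assms
    by (metis D_carrier rcos_self)
qed

lemma proj_eq_iff:
  assumes "d \<in> D" "e \<in> D"
  shows "proj d = proj e \<longleftrightarrow> quandle.nbrs d = quandle.nbrs e"
proof
  assume "proj d = proj e"
  then have "e \<in> d <# tau_subgroup G D" using mem_l_coset_iff assms by simp
  then obtain t where t: "t \<in> tau_subgroup G D" "e = d \<otimes> t" by (auto simp: l_coset_def)
  have "inv t \<in> tau_subgroup G D" using t(1) tau_subgroup_subgroup by (simp add: subgroup.m_inv_closed)
  moreover have "d = e \<otimes> inv t" using t assms tau_subgroup_carrier by (simp add: m_assoc)
  ultimately show "quandle.nbrs d = quandle.nbrs e"
    using nbrs_mult_tau assms t by (metis subset_antisym)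
next
  assume "quandle.nbrs d = quandle.nbrs e"
  then have "d \<otimes> e \<in> tau_subgroup G D"
    unfolding tau_subgroup_def using assms
    by (intro generate.incl CollectI exI[of _ d] exI[of _ e]) (simp add: tau_rel_iff)
  moreover have "e = d \<otimes> (d \<otimes> e)" using assms by simp
  ultimately have "e \<in> d <# tau_subgroup G D" unfolding l_coset_def by blast
  then show "proj d = proj e" using mem_l_coset_iff assms by simp
qed

text \<open>Under the projection an order can only drop to a divisor, and 3 cannot drop to 1 because
  adjacent points are not twins.\<close>

lemma collinear_proj_iff:
  assumes "d \<in> D" "e \<in> D"
  shows "proj e \<in> collinear_set (tau_quotient G D) (tau_quotient_set G D) (proj d)
    \<longleftrightarrow> e \<in> collinear_set G D d"
proof -
  let ?G' = "tau_quotient G D"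
  note N = tau_subgroup_normal
  interpret G': group ?G' unfolding tau_quotient_def by (rule normal.factorgroup_is_group[OF N])
  have hom: "(#>) (tau_subgroup G D) \<in> hom G ?G'"
    unfolding tau_quotient_def by (rule normal.r_coset_hom_Mod[OF N])
  have de: "d \<otimes> e \<in> carrier G" using assms by simp
  have mult: "proj d \<otimes>\<^bsub>?G'\<^esub> proj e = proj (d \<otimes> e)"
    using hom_mult[OF hom] assms by simp
  have carr: "proj (d \<otimes> e) \<in> carrier ?G'" using hom_in_carrier[OF hom de] .
  have one: "proj \<one> = \<one>\<^bsub>?G'\<^esub>" using hom_one[OF hom group_axioms G'.group_axioms] .
  have pow: "G'.ord (proj (d \<otimes> e)) dvd n" if "(d \<otimes> e) [^] n = \<one>" for n :: nat
    using hom_nat_pow[OF hom de group_axioms G'.group_axioms, of n] that one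
      G'.pow_eq_id[OF carr] by metis
  have "G'.ord (proj (d \<otimes> e)) = 3 \<longleftrightarrow> ord (d \<otimes> e) = 3"
  proof
    assume "ord (d \<otimes> e) = 3"
    then have adj: "quandle.adj d e" and "(d \<otimes> e) [^] (3::nat) = \<one>"
      using assms pow_ord_eq_1[OF de] by (simp_all add: adj_iff)
    then have "G'.ord (proj (d \<otimes> e)) dvd 3" using pow by blast
    moreover have "G'.ord (proj (d \<otimes> e)) \<noteq> 1"
    proof
      assume "G'.ord (proj (d \<otimes> e)) = 1"
      then have "proj (d \<otimes> e) = \<one>\<^bsub>?G'\<^esub>" using G'.ord_eq_1[OF carr] by simp
      then have "proj (d \<otimes> e) = tau_subgroup G D" by (simp add: tau_quotient_def FactGroup_def)
      then have "d \<otimes> e \<in> tau_subgroup G D"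
        using coset_join1 tau_subgroup_subgroup de by metis
      moreover have "e = d \<otimes> (d \<otimes> e)" using assms by simp
      ultimately have "e \<in> d <# tau_subgroup G D" unfolding l_coset_def by blast
      then have "quandle.nbrs d = quandle.nbrs e" using mem_l_coset_iff proj_eq_iff assms by metis
      then show False using adj by (metis quandle.mem_nbrs quandle.not_adj_self)
    qed
    moreover have "n = 3" if "n dvd 3" "n \<noteq> 1" for n :: nat
    proof -
      have "n \<le> 3" using dvd_imp_le[OF that(1)] by simp
      then have "n = 0 \<or> n = 1 \<or> n = 2 \<or> n = 3" by linarith
      then show ?thesis using that by auto
    qed
    ultimately show "G'.ord (proj (d \<otimes> e)) = 3" by blast
  next
    assume *: "G'.ord (proj (d \<otimes> e)) = 3"
    show "ord (d \<otimes> e) = 3"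
    proof (rule ccontr)
      assume "ord (d \<otimes> e) \<noteq> 3"
      then have "(d \<otimes> e) [^] (2::nat) = \<one>"
        using ord_product_eq_3_iff conj_eq_iff assms by metis
      then show False using pow[of 2] * by simp
    qed
  qed
  then show ?thesis
    using assms by (simp add: collinear_set_def tau_quotient_set_def mult)
qed

end

section \<open>Connectedness and assembly of the result\<close>

context connected_three_transposition_group
begin

text \<open>Each generator fixes a point or moves it along an edge, and products of generators
  concatenate such paths.\<close>

lemma adj_rtranclp_conj:
  assumes "g \<in> carrier G" "x \<in> D"
  shows "quandle.adj\<^sup>*\<^sup>* x (g \<otimes> x \<otimes> inv g)"
proof -
  have step: "quandle.adj\<^sup>*\<^sup>* x (h \<otimes> x \<otimes> inv h)" if "h \<in> D" "x \<in> D" for h x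
  proof (cases "quandle.adj h x")
    case True
    then have "quandle.adj x (reflect h x)" by (rule quandle.adj_line(2))
    then show ?thesis using that by (simp add: reflect_def)
  next
    case False
    then have "reflect h x = x" by simp
    then show ?thesis using that by (simp add: reflect_def)
  qed
  have "\<forall>x\<in>D. quandle.adj\<^sup>*\<^sup>* x (g \<otimes> x \<otimes> inv g)" if "g \<in> generate G D"
    using that
  proof (induction g rule: generate.induct)
    case (eng s t)
    then have st: "s \<in> carrier G" "t \<in> carrier G" using D_generates by auto
    show ?case
    proof
      fix x assume x: "x \<in> D"
      have "quandle.adj\<^sup>*\<^sup>* x (t \<otimes> x \<otimes> inv t)" using eng.IH(2) x by blast
      also have "quandle.adj\<^sup>*\<^sup>* (t \<otimes> x \<otimes> inv t) (s \<otimes> (t \<otimes> x \<otimes> inv t) \<otimes> inv s)"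
        using eng.IH(1) D_normal[OF st(2) x] by blast
      finally show "quandle.adj\<^sup>*\<^sup>* x (s \<otimes> t \<otimes> x \<otimes> inv (s \<otimes> t))"
        using conj_comp[of s t x] st x by simp
    qed
  next
    case (incl h)
    then show ?case using step by blast
  next
    case (inv h)
    then show ?case using step[of h] by simp
  qed simp
  then show ?thesis using assms D_generates by simp
qed

lemma connected_quandle:
  assumes "tau_subgroup G D \<noteq> {\<one>}"
  shows "connected_reflection_quandle D reflect"
proof unfold_locales
  obtain d0 where d0: "d0 \<in> D" "D = {g \<otimes> d0 \<otimes> inv g | g. g \<in> carrier G}"
    using connected by blast
  show conn: "quandle.adj\<^sup>*\<^sup>* x y" if "x \<in> D" "y \<in> D" for x y
  proof -
    obtain g where g: "g \<in> carrier G" "x = g \<otimes> d0 \<otimes> inv g" using d0(2) \<open>x \<in> D\<close> by blast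
    obtain k where k: "k \<in> carrier G" "y = k \<otimes> d0 \<otimes> inv k" using d0(2) \<open>y \<in> D\<close> by blast
    have "d0 = inv g \<otimes> x \<otimes> inv (inv g)"
      using conj_comp[of "inv g" g d0] g d0(1) by simp
    then have "y = (k \<otimes> inv g) \<otimes> x \<otimes> inv (k \<otimes> inv g)"
      using conj_comp[of k "inv g" x] k g that by simp
    then show ?thesis using adj_rtranclp_conj[of "k \<otimes> inv g" x] g k that by simp
  qed
  \<comment> \<open>Without edges connectedness leaves a single point, whose only twin product is
    its square, the identity.\<close>
  show "\<exists>x y. quandle.adj x y"
  proof (rule ccontr)
    assume no: "\<not> ?thesis"
    have eq: "x = y" if "x \<in> D" "y \<in> D" for x y
      using conn[OF that] no by (metis rtranclp.cases)
    have "twin_products = {\<one>}"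
    proof (intro equalityI subsetI)
      fix a assume "a \<in> twin_products"
      then obtain d e where "a = d \<otimes> e" "d \<in> D" "e \<in> D" by blast
      then show "a \<in> {\<one>}" using eq[of d e] by simp
    next
      fix a assume "a \<in> {\<one>}"
      then have "a = d0 \<otimes> d0" using d0(1) by simp
      then show "a \<in> twin_products" using d0(1) unfolding tau_rel_def by blast
    qed
    then have "tau_subgroup G D = {\<one>}" by (simp add: tau_subgroup_def generate_one)
    then show False using assms by simp
  qed
qed

lemma collinearity_blowup_proj:
  assumes "two_bullet_extension G D h"
  shows "collinearity_blowup G D (tau_quotient G D) (tau_quotient_set G D) proj (2 ^ h)"
proof
  show "proj ` D = tau_quotient_set G D" by (simp add: tau_quotient_set_def)
  show "card {e \<in> D. proj e = proj d} = 2 ^ h" if d: "d \<in> D" for d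
  proof -
    have "{e \<in> D. proj e = proj d} = D \<inter> (d <# tau_subgroup G D)"
      using mem_l_coset_iff d by auto
    then show ?thesis using assms d by (simp add: two_bullet_extension_def)
  qed
  show "c \<in> collinear_set G D d \<longleftrightarrow> d \<in> collinear_set G D c" if "c \<in> D" "d \<in> D" for c d
    using that quandle.adj_sym by (simp add: collinear_set_eq)
qed (use finite_D collinear_proj_iff in auto)

end

theorem corollary10p2:
  fixes G :: "('a, 'b) monoid_scheme" and D :: "'a set"
    and \<eta> :: "'f::field_char_0" and h :: nat
  assumes "connected_three_transposition_group G D"
    and "\<eta> \<noteq> 0" and "\<eta> \<noteq> 1"
    and "tau_subgroup G D \<noteq> {\<one>\<^bsub>G\<^esub>}"
    and "two_bullet_extension G D h"
  shows "let G' = tau_quotient G D; D' = tau_quotient_set G D;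
             M = matsuo_space \<eta> D; M' = matsuo_space \<eta> D';
             t = collinearity_map G D; t' = collinearity_map G' D';
             U = tau_difference_space G D :: ('a \<Rightarrow> 'f) set
         in (\<forall>\<rho>. \<rho> \<noteq> 0 \<and> eigenvalue_on M t \<rho> \<longrightarrow>
              (\<exists>\<rho>'. eigenvalue_on M' t' \<rho>' \<and> \<rho> = 2 ^ h * \<rho>' \<and>
                    multiplicity_on M t \<rho> = multiplicity_on M' t' \<rho>'))
          \<and> int (multiplicity_on M t 0) = int (fun_space.dim U)
          \<and> int (fun_space.dim U) = int (fun_space.dim M) - int (fun_space.dim M')
          \<and> int (fun_space.dim M) - int (fun_space.dim M') = int (card D) - int (card D')
          \<and> int (card D) - int (card D') = (2 ^ h - 1) * int (card D')"
proof -
  interpret connected_three_transposition_group G D by fact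
  interpret conn: connected_reflection_quandle D reflect by (rule connected_quandle) fact
  interpret blow: collinearity_blowup G D "tau_quotient G D" "tau_quotient_set G D" proj "2 ^ h"
    by (rule collinearity_blowup_proj) fact
  let ?D' = "tau_quotient_set G D"
  let ?M = "matsuo_space \<eta> D" and ?M' = "matsuo_space \<eta> ?D'"
  let ?t = "collinearity_map G D" and ?t' = "collinearity_map (tau_quotient G D) ?D'"
  let ?U = "tau_difference_space G D :: ('a \<Rightarrow> 'f) set"
  have a: "\<exists>\<rho>'. eigenvalue_on ?M' ?t' \<rho>' \<and> \<rho> = 2 ^ h * \<rho>' \<and>
      multiplicity_on ?M ?t \<rho> = multiplicity_on ?M' ?t' \<rho>'"
    if "\<rho> \<noteq> 0" "eigenvalue_on ?M ?t \<rho>" for \<rho>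
    using blow.nonzero_eigenvalue[OF that] by (intro exI[of _ "\<rho> / 2 ^ h"]) simp
  have ker: "(\<Sum>e | e \<in> D \<and> proj e = proj x. v e) = 0"
    if "\<And>x. x \<in> D \<Longrightarrow> sum v (collinear_set G D x) = 0" "x \<in> D" for v :: "'a \<Rightarrow> 'f" and x
  proof -
    have "{e. e \<in> D \<and> proj e = proj x} = {e. e \<in> D \<and> quandle.nbrs e = quandle.nbrs x}"
      using proj_eq_iff that(2) by auto
    moreover have "(\<Sum>e | e \<in> D \<and> quandle.nbrs e = quandle.nbrs x. v e) = 0"
      by (rule conn.class_sum_eq_0) (use that collinear_set_eq in auto)
    ultimately show ?thesis by simp
  qed
  have U: "?U = blow.fibre_sum_zero"
    by (rule blow.tau_difference_space_eq) (simp add: tau_rel_iff proj_eq_iff)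
  have "multiplicity_on ?M ?t 0 = fun_space.dim ?U"
    unfolding multiplicity_on_def U using blow.eigenspace_zero[of \<eta>] ker by metis
  moreover have "fun_space.dim ?M = card D" "fun_space.dim ?M' = card ?D'"
    using dim_matsuo_space finite_D blow.finite_D' by auto
  moreover have "fun_space.dim ?U = card D - card ?D'"
    unfolding U by (rule blow.dim_fibre_sum_zero)
  moreover have "card ?D' \<le> card D" by (simp add: blow.card_D)
  moreover have "int (card D) - int (card ?D') = (2 ^ h - 1) * int (card ?D')"
    by (simp add: blow.card_D algebra_simps)
  ultimately show ?thesis
    unfolding Let_def using a by (auto simp: of_nat_diff)
qed

end
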